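(* Let $M$ be an oriented immersed hypersurface of $\mathbb{S}^{7}$, and let $\gamma:M\to\mathbb{S}^{6}\subset T_{1}\mathbb{S}^{7}$ be the (octonionic) Gauss map of $M$ determined by a unit normal vector field $\eta$ along $M$, i.e. $\gamma(x)=\Gamma_x(\eta(x))=x^{-1}\cdot\eta(x)$. Then $$\Delta\gamma(x)=-6\,\Gamma_{x}\left(\operatorname{grad}H(x)\right)-\left(6+\|A(x)\|^{2}\right)\gamma(x),\quad x\in M,$$ where $H:M\to\mathbb{R}$ is the mean curvature function of $M$ with respect to $\eta$, $\operatorname{grad}H$ is its gradient on $M$, $A$ is the second fundamental form of $M$ and $\|A\|$ is its norm.
   Context: $\mathbb{S}^7$ is the unit sphere of $\mathbb{R}^8$ identified with the octonions; $\cdot$ is octonionic multiplication, with unit $1\in\mathbb{S}^7$. For $x\in\mathbb{S}^7$ and $v\in T_x\mathbb{S}^7\subset\mathbb{R}^8$ put $\Gamma_x(v)=x^{-1}\cdot v\in T_1\mathbb{S}^7$. $\mathbb{S}^6$ is the unit sphere centered at the origin of $T_1\mathbb{S}^7\cong\mathbb{R}^7$. For the immersed hypersurface $M$, points of $M$ are identified locally with their images in $\mathbb{S}^7$, and $M$ carries the induced metric. The Laplacian of $\gamma$ is taken componentwise: $\Delta\gamma=\sum_{j=1}^{7}\Delta_M(\langle\gamma,v_j\rangle)\,v_j$, where $\{v_1,\dots,v_7\}$ is any orthonormal basis of $T_1\mathbb{S}^7$ and $\Delta_M=\operatorname{div}\operatorname{grad}$ is the Laplacian on functions of $M$. Conventions: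 $A(X)=-\nabla_X\eta$ with $\nabla$ the Levi-Civita connection of $\mathbb{S}^7$, $H=\frac{1}{6}\operatorname{tr}A$, $\|A\|^2=\operatorname{tr}(A^2)$. *)

theory Defs
  imports "HOL-Analysis.Analysis"
begin

section \<open>Octonions\<close>

text \<open>Quaternions and octonions are obtained from the complex numbers by two Cayley-Dickson
  doublings, \<open>(a, b) (c, d) = (a c - d\<^sup>* b, d a + b c\<^sup>*)\<close> and \<open>(a, b)\<^sup>* = (a\<^sup>*, - b)\<close>. The
  library inner product and norm of the iterated product type are those of \<open>\<real>\<^sup>8\<close>.\<close>

type_synonym quat = "complex \<times> complex"
type_synonym oct = "quat \<times> quat"

definition qcnj :: "quat \<Rightarrow> quat" where
  "qcnj x = (cnj (fst x), - snd x)"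

definition qmult :: "quat \<Rightarrow> quat \<Rightarrow> quat" where
  "qmult x y = (fst x * fst y - cnj (snd y) * snd x, snd y * fst x + snd x * cnj (fst y))"

definition ocnj :: "oct \<Rightarrow> oct" where
  "ocnj x = (qcnj (fst x), - snd x)"

definition omult :: "oct \<Rightarrow> oct \<Rightarrow> oct"  (infixl "\<odot>" 70) where
  "x \<odot> y = (qmult (fst x) (fst y) - qmult (qcnj (snd y)) (snd x),
            qmult (snd y) (fst x) + qmult (snd x) (qcnj (fst y)))"

definition oone :: oct where
  "oone = ((1, 0), (0, 0))"

definition oinv :: "oct \<Rightarrow> oct" where
  "oinv x = (1 / (norm x)\<^sup>2) *\<^sub>R ocnj x"

lemma DIM_oct: "DIM(oct) = 8"
  by simp

lemma oone_neutral: "oone \<odot> x = x" "x \<odot> oone = x"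
  by (simp_all add: oone_def omult_def qmult_def qcnj_def prod_eq_iff)

lemma norm_oct_power2:
  "(norm (x::oct))\<^sup>2 =
     (Re (fst (fst x)))\<^sup>2 + (Im (fst (fst x)))\<^sup>2 + (Re (snd (fst x)))\<^sup>2 + (Im (snd (fst x)))\<^sup>2 +
     (Re (fst (snd x)))\<^sup>2 + (Im (fst (snd x)))\<^sup>2 + (Re (snd (snd x)))\<^sup>2 + (Im (snd (snd x)))\<^sup>2"
  by (cases x) (auto simp: norm_prod_def cmod_power2)

lemma oinv_omult_cancel:
  assumes "x \<noteq> 0"
  shows "oinv x \<odot> (x \<odot> y) = y"
proof -
  have lin: "(r *\<^sub>R a) \<odot> b = r *\<^sub>R (a \<odot> b)" for r a b
    by (simp add: omult_def qmult_def qcnj_def complex_eq_iff prod_eq_iff algebra_simps)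
  have "ocnj x \<odot> (x \<odot> y) = (norm x)\<^sup>2 *\<^sub>R y"
    unfolding norm_oct_power2
    by (simp add: omult_def qmult_def qcnj_def ocnj_def complex_eq_iff prod_eq_iff
        algebra_simps power2_eq_square)
  with assms show ?thesis
    by (simp add: oinv_def lin)
qed

text \<open>The tangent space of the unit sphere at \<open>x\<close>, and the left translation of \<open>T\<^sub>x\<close> to \<open>T\<^sub>1\<close>.\<close>

definition sphere_tangent :: "oct \<Rightarrow> oct set" where
  "sphere_tangent x = {v. v \<bullet> x = 0}"

definition Gam :: "oct \<Rightarrow> oct \<Rightarrow> oct" where
  "Gam x v = oinv x \<odot> v"

definition orthonormal_basis :: "'a::real_inner set \<Rightarrow> 'a set \<Rightarrow> bool" where
  "orthonormal_basis B S \<longleftrightarrow> pairwise orthogonal B \<and> (\<forall>b\<in>B. norm b = 1) \<and> span B = S"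


section \<open>Smooth manifolds of dimension six\<close>

primrec Ck_on :: "nat \<Rightarrow> 'a::real_normed_vector set \<Rightarrow> ('a \<Rightarrow> 'b::real_normed_vector) \<Rightarrow> bool" where
  "Ck_on 0 S u \<longleftrightarrow> continuous_on S u"
| "Ck_on (Suc k) S u \<longleftrightarrow>
     u differentiable_on S \<and> (\<forall>v. Ck_on k S (\<lambda>x. frechet_derivative u (at x) v))"

definition smooth_on :: "'a::real_normed_vector set \<Rightarrow> ('a \<Rightarrow> 'b::real_normed_vector) \<Rightarrow> bool" where
  "smooth_on S u \<longleftrightarrow> (\<forall>k. Ck_on k S u)"

text \<open>A chart is a pair of a domain and a coordinate map; only the values of the coordinate map on
  the domain matter.\<close>

type_synonym 'm chart = "'m set \<times> ('m \<Rightarrow> real^6)"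

definition param :: "'m chart \<Rightarrow> real^6 \<Rightarrow> 'm" where
  "param c = inv_into (fst c) (snd c)"

definition is_chart :: "'m topology \<Rightarrow> 'm chart \<Rightarrow> bool" where
  "is_chart M c \<longleftrightarrow> openin M (fst c) \<and> open (snd c ` fst c) \<and>
     homeomorphic_map (subtopology M (fst c)) (top_of_set (snd c ` fst c)) (snd c)"

definition smooth_atlas :: "'m topology \<Rightarrow> 'm chart set \<Rightarrow> bool" where
  "smooth_atlas M \<A> \<longleftrightarrow>
     (\<forall>c\<in>\<A>. is_chart M c) \<and> (\<Union>c\<in>\<A>. fst c) = topspace M \<and>
     (\<forall>c\<in>\<A>. \<forall>d\<in>\<A>. smooth_on (snd c ` (fst c \<inter> fst d)) (snd d \<circ> param c))"

definition smooth_manifold6 :: "'m topology \<Rightarrow> 'm chart set \<Rightarrow> bool" where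
  "smooth_manifold6 M \<A> \<longleftrightarrow> Hausdorff_space M \<and> second_countable M \<and> smooth_atlas M \<A>"

definition smooth_map :: "'m chart set \<Rightarrow> ('m \<Rightarrow> 'b::real_normed_vector) \<Rightarrow> bool" where
  "smooth_map \<A> u \<longleftrightarrow> (\<forall>c\<in>\<A>. smooth_on (snd c ` fst c) (u \<circ> param c))"

text \<open>The derivative at \<open>p\<close> of a map on the manifold, read in a chart \<open>c\<close> around \<open>p\<close>.\<close>

definition cderiv :: "'m chart \<Rightarrow> ('m \<Rightarrow> 'b::real_normed_vector) \<Rightarrow> 'm \<Rightarrow> real^6 \<Rightarrow> 'b" where
  "cderiv c u p = frechet_derivative (u \<circ> param c) (at (snd c p))"

abbreviation pd :: "'m chart \<Rightarrow> ('m \<Rightarrow> 'b::real_normed_vector) \<Rightarrow> 6 \<Rightarrow> 'm \<Rightarrow> 'b" where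
  "pd c u i p \<equiv> cderiv c u p (axis i 1)"

text \<open>An arbitrary chart around \<open>p\<close> serves to evaluate the operators below at \<open>p\<close>. They all denote
  chart-independent objects.\<close>

definition chart_at :: "'m chart set \<Rightarrow> 'm \<Rightarrow> 'm chart" where
  "chart_at \<A> p = (SOME c. c \<in> \<A> \<and> p \<in> fst c)"

definition mderiv :: "'m chart set \<Rightarrow> ('m \<Rightarrow> 'b::real_normed_vector) \<Rightarrow> 'm \<Rightarrow> real^6 \<Rightarrow> 'b" where
  "mderiv \<A> u p = cderiv (chart_at \<A> p) u p"


section \<open>Immersed hypersurfaces of the seven-sphere\<close>

definition immersed_hypersurface :: "'m topology \<Rightarrow> 'm chart set \<Rightarrow> ('m \<Rightarrow> oct) \<Rightarrow> bool" where
  "immersed_hypersurface M \<A> f \<longleftrightarrow> smooth_manifold6 M \<A> \<and> smooth_map \<A> f \<and>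
     (\<forall>p\<in>topspace M. f p \<in> sphere 0 1 \<and> inj (mderiv \<A> f p))"

text \<open>Tangent vectors of the hypersurface at \<open>p\<close> are identified with their images in \<open>\<real>\<^sup>8\<close> under
  the differential of the immersion \<open>f\<close>; the induced metric is then the inner product of \<open>\<real>\<^sup>8\<close>.\<close>

definition tangent_space :: "'m chart set \<Rightarrow> ('m \<Rightarrow> oct) \<Rightarrow> 'm \<Rightarrow> oct set" where
  "tangent_space \<A> f p = range (mderiv \<A> f p)"

definition unit_normal ::
    "'m topology \<Rightarrow> 'm chart set \<Rightarrow> ('m \<Rightarrow> oct) \<Rightarrow> ('m \<Rightarrow> oct) \<Rightarrow> bool" where
  "unit_normal M \<A> f \<eta> \<longleftrightarrow> smooth_map \<A> \<eta> \<and>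
     (\<forall>p\<in>topspace M. \<eta> p \<in> sphere_tangent (f p) \<and> norm (\<eta> p) = 1 \<and>
        (\<forall>w\<in>tangent_space \<A> f p. \<eta> p \<bullet> w = 0))"

definition tangent_trace ::
    "'m chart set \<Rightarrow> ('m \<Rightarrow> oct) \<Rightarrow> 'm \<Rightarrow> (oct \<Rightarrow> oct) \<Rightarrow> real" where
  "tangent_trace \<A> f p L = trace (matrix (inv (mderiv \<A> f p) \<circ> L \<circ> mderiv \<A> f p))"


subsection \<open>Gradient, Levi-Civita connection, divergence and Laplacian of the induced metric\<close>

definition grad :: "'m chart set \<Rightarrow> ('m \<Rightarrow> oct) \<Rightarrow> ('m \<Rightarrow> real) \<Rightarrow> 'm \<Rightarrow> oct" where
  "grad \<A> f u p = (THE w. w \<in> tangent_space \<A> f p \<and>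
     (\<forall>v. w \<bullet> mderiv \<A> f p v = mderiv \<A> u p v))"

definition metric_coeff :: "'m chart \<Rightarrow> ('m \<Rightarrow> oct) \<Rightarrow> 6 \<Rightarrow> 6 \<Rightarrow> 'm \<Rightarrow> real" where
  "metric_coeff c f i j p = pd c f i p \<bullet> pd c f j p"

definition metric_inv :: "'m chart \<Rightarrow> ('m \<Rightarrow> oct) \<Rightarrow> 6 \<Rightarrow> 6 \<Rightarrow> 'm \<Rightarrow> real" where
  "metric_inv c f i j p = matrix_inv (\<chi> k l. metric_coeff c f k l p) $ i $ j"

definition christoffel :: "'m chart \<Rightarrow> ('m \<Rightarrow> oct) \<Rightarrow> 6 \<Rightarrow> 6 \<Rightarrow> 6 \<Rightarrow> 'm \<Rightarrow> real" where
  "christoffel c f k i j p = (1/2) * (\<Sum>l\<in>UNIV. metric_inv c f k l p *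
     (pd c (metric_coeff c f j l) i p + pd c (metric_coeff c f i l) j p - pd c (metric_coeff c f i j) l p))"

definition component :: "'m chart \<Rightarrow> ('m \<Rightarrow> oct) \<Rightarrow> ('m \<Rightarrow> oct) \<Rightarrow> 6 \<Rightarrow> 'm \<Rightarrow> real" where
  "component c f X k q = inv (cderiv c f q) (X q) $ k"

definition levi_civita ::
    "'m chart set \<Rightarrow> ('m \<Rightarrow> oct) \<Rightarrow> ('m \<Rightarrow> oct) \<Rightarrow> 'm \<Rightarrow> oct \<Rightarrow> oct" where
  "levi_civita \<A> f X p w =
     (let c = chart_at \<A> p; v = inv (cderiv c f p) w in
      \<Sum>k\<in>UNIV. (cderiv c (component c f X k) p v +
        (\<Sum>i\<in>UNIV. \<Sum>j\<in>UNIV. christoffel c f k i j p * v $ i * component c f X j p)) *\<^sub>R pd c f k p)"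

definition divergence :: "'m chart set \<Rightarrow> ('m \<Rightarrow> oct) \<Rightarrow> ('m \<Rightarrow> oct) \<Rightarrow> 'm \<Rightarrow> real" where
  "divergence \<A> f X p = tangent_trace \<A> f p (levi_civita \<A> f X p)"

definition laplacian :: "'m chart set \<Rightarrow> ('m \<Rightarrow> oct) \<Rightarrow> ('m \<Rightarrow> real) \<Rightarrow> 'm \<Rightarrow> real" where
  "laplacian \<A> f u = divergence \<A> f (grad \<A> f u)"

definition vlaplacian ::
    "oct set \<Rightarrow> 'm chart set \<Rightarrow> ('m \<Rightarrow> oct) \<Rightarrow> ('m \<Rightarrow> oct) \<Rightarrow> 'm \<Rightarrow> oct" where
  "vlaplacian B \<A> f u p = (\<Sum>b\<in>B. laplacian \<A> f (\<lambda>q. u q \<bullet> b) p *\<^sub>R b)"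


subsection \<open>Second fundamental form and Gauss map\<close>

text \<open>The Levi-Civita connection of the round sphere applied to a vector field \<open>Y\<close> along \<open>f\<close>, in
  the direction \<open>w\<close>: the part of the Euclidean derivative tangent to the sphere.\<close>

definition sphere_connection ::
    "'m chart set \<Rightarrow> ('m \<Rightarrow> oct) \<Rightarrow> ('m \<Rightarrow> oct) \<Rightarrow> 'm \<Rightarrow> oct \<Rightarrow> oct" where
  "sphere_connection \<A> f Y p w =
     (let d = mderiv \<A> Y p (inv (mderiv \<A> f p) w) in d - (d \<bullet> f p) *\<^sub>R f p)"

definition shape ::
    "'m chart set \<Rightarrow> ('m \<Rightarrow> oct) \<Rightarrow> ('m \<Rightarrow> oct) \<Rightarrow> 'm \<Rightarrow> oct \<Rightarrow> oct" where
  "shape \<A> f \<eta> p w = - sphere_connection \<A> f \<eta> p w"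

definition mean_curvature ::
    "'m chart set \<Rightarrow> ('m \<Rightarrow> oct) \<Rightarrow> ('m \<Rightarrow> oct) \<Rightarrow> 'm \<Rightarrow> real" where
  "mean_curvature \<A> f \<eta> p = (1/6) * tangent_trace \<A> f p (shape \<A> f \<eta> p)"

definition shape_norm_sq ::
    "'m chart set \<Rightarrow> ('m \<Rightarrow> oct) \<Rightarrow> ('m \<Rightarrow> oct) \<Rightarrow> 'm \<Rightarrow> real" where
  "shape_norm_sq \<A> f \<eta> p = tangent_trace \<A> f p (shape \<A> f \<eta> p \<circ> shape \<A> f \<eta> p)"

definition gauss_map :: "('m \<Rightarrow> oct) \<Rightarrow> ('m \<Rightarrow> oct) \<Rightarrow> 'm \<Rightarrow> oct" where
  "gauss_map f \<eta> p = Gam (f p) (\<eta> p)"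

end

theory Submission
  imports Defs
begin

text \<open>On the unit sphere \<open>x\<^sup>-\<^sup>1 = x\<^sup>*\<close>, so in local coordinates the Gauss map is \<open>F\<^sup>* N\<close>, where \<open>F\<close> is the
  immersion, \<open>N\<close> the normal and the product is bilinear. The Leibniz rule for the Laplacian of the
  induced metric gives, for an orthonormal basis \<open>W\<close> of the tangent space at the point,
  \<open>\<Delta>(F\<^sup>* N) = (\<Delta>F)\<^sup>* N + 2 \<Sum>\<^sub>w w\<^sup>* (\<partial>\<^sub>w N) + F\<^sup>* \<Delta>N\<close>. Three facts evaluate the right-hand side.

  \<^item> \<open>\<Delta>F = (tr A) N - 6 F\<close>, because the Hessian of \<open>F\<close> is normal, with components given by the second
  fundamental form and minus the metric (\<open>lap_F\<close>).

  \<^item> \<open>\<Delta>N = (tr A) F - |A|\<^sup>2 N - grad (tr A)\<close>; the tangential component is the Codazzi equation, the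
  derivative of the symmetry of the second fundamental form (\<open>lap_N\<close>, \<open>codazzi\<close>).

  \<^item> \<open>\<Sum>\<^sub>w w\<^sup>* (\<partial>\<^sub>w N) = - (tr A) 1\<close>, because \<open>\<partial>\<^sub>w N = - A w\<close> with \<open>A\<close> symmetric and
  \<open>u\<^sup>* v + v\<^sup>* u = 2 \<langle>u, v\<rangle> 1\<close> (\<open>sum_ocnj_omult_N1\<close>).

  Since \<open>N\<^sup>* N = F\<^sup>* F = 1\<close>, the multiples of the unit cancel, and with \<open>tr A = 6 H\<close> there remains
  \<open>- 6 F\<^sup>* grad H - (6 + |A|\<^sup>2) F\<^sup>* N\<close> (\<open>lap_gauss\<close>).

  The other half of the work identifies the operators with their local expressions. Gradients, traces
  and the shape operator at a point refer to a chart chosen at that point; they are rewritten in a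
  single chart by the chain rule. There, the gradient of a function and the shape operator solve
  linear systems whose matrix is the metric. By Cramer's rule the solutions are differentiable, and
  differentiating the systems themselves yields the divergence of the gradient as the trace of a
  Hessian (\<open>divergence_gradient\<close>) and the derivative of \<open>tr A\<close> (\<open>tr_shape_has_derivative\<close>).\<close>

section \<open>Second derivatives of smooth maps\<close>

text \<open>A second difference quotient over a parallelogram equals a mixed second derivative at a nearby
  point. Exchanging the two sides of the parallelogram leaves the difference unchanged, whence the
  symmetry of continuous second derivatives.\<close>

lemma second_difference_mean_value:
  fixes \<phi> :: "'a::real_normed_vector \<Rightarrow> real"
  assumes D1: "\<And>y. y \<in> ball p r \<Longrightarrow> (\<phi> has_derivative D\<phi> y) (at y)"
    and D2: "\<And>y. y \<in> ball p r \<Longrightarrow> ((\<lambda>z. D\<phi> z v) has_derivative (\<lambda>u. D2 y u v)) (at y)"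
    and h: "0 < h" "h * (norm v + norm w) < r"
  shows "\<exists>y. dist p y \<le> h * (norm v + norm w) \<and>
    \<phi> (p + h *\<^sub>R v + h *\<^sub>R w) - \<phi> (p + h *\<^sub>R v) - \<phi> (p + h *\<^sub>R w) + \<phi> p = h * h * D2 y w v"
proof -
  have small: "dist p (p + s *\<^sub>R v + t *\<^sub>R w) \<le> h * (norm v + norm w)"
    if "0 \<le> s" "s \<le> h" "0 \<le> t" "t \<le> h" for s t
  proof -
    have "norm (s *\<^sub>R v + t *\<^sub>R w) \<le> s * norm v + t * norm w"
      using norm_triangle_ineq[of "s *\<^sub>R v" "t *\<^sub>R w"] that by simp
    also have "\<dots> \<le> h * (norm v + norm w)"
      using that by (auto simp: distrib_left intro!: add_mono mult_right_mono)
    also have "norm (s *\<^sub>R v + t *\<^sub>R w) = dist p (p + s *\<^sub>R v + t *\<^sub>R w)"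
      by (metis add.assoc add_diff_cancel_left' dist_commute dist_norm)
    finally show ?thesis .
  qed
  have inb: "p + s *\<^sub>R v + t *\<^sub>R w \<in> ball p r" if "0 \<le> s" "s \<le> h" "0 \<le> t" "t \<le> h" for s t
    using small[OF that] h by auto
  \<comment> \<open>one mean value in the direction \<open>v\<close>, then one in the direction \<open>w\<close>\<close>
  define g where "g s = \<phi> (p + s *\<^sub>R v + h *\<^sub>R w) - \<phi> (p + s *\<^sub>R v + 0 *\<^sub>R w)" for s :: real
  have g: "(g has_derivative (\<lambda>\<tau>. D\<phi> (p + s *\<^sub>R v + h *\<^sub>R w) (\<tau> *\<^sub>R v)
      - D\<phi> (p + s *\<^sub>R v + 0 *\<^sub>R w) (\<tau> *\<^sub>R v))) (at s within {0..h})" if "0 \<le> s" "s \<le> h" for s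
    unfolding g_def using that h
    by (intro has_derivative_diff;
        intro has_derivative_compose[where g=\<phi>, OF _ D1] inb)
       (auto intro!: derivative_eq_intros)
  obtain s where s: "s \<in> {0<..<h}" and gs: "g h - g 0 = D\<phi> (p + s *\<^sub>R v + h *\<^sub>R w) ((h - 0) *\<^sub>R v)
      - D\<phi> (p + s *\<^sub>R v + 0 *\<^sub>R w) ((h - 0) *\<^sub>R v)"
    using mvt_simple[OF h(1) g] by blast
  define k where "k t = D\<phi> (p + s *\<^sub>R v + t *\<^sub>R w) v" for t :: real
  have k: "(k has_derivative (\<lambda>\<tau>. D2 (p + s *\<^sub>R v + t *\<^sub>R w) (\<tau> *\<^sub>R w) v)) (at t within {0..h})"
    if "0 \<le> t" "t \<le> h" for t
    unfolding k_def using that s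
    by (intro has_derivative_compose[where g="\<lambda>z. D\<phi> z v", OF _ D2] inb)
       (auto intro!: derivative_eq_intros)
  obtain t where t: "t \<in> {0<..<h}" and kt: "k h - k 0 = D2 (p + s *\<^sub>R v + t *\<^sub>R w) ((h - 0) *\<^sub>R w) v"
    using mvt_simple[OF h(1) k] by blast
  have lin1: "linear (D\<phi> y)" if "y \<in> ball p r" for y
    using D1[OF that] has_derivative_linear by blast
  have lin2: "linear (\<lambda>u. D2 y u v)" if "y \<in> ball p r" for y
    using D2[OF that] has_derivative_linear by blast
  have "g h - g 0 = h * (k h - k 0)"
    unfolding gs k_def using s h
    by (simp add: linear_cmul[OF lin1[OF inb]] linear_cmul[OF lin1[OF inb[of _ 0], simplified]] right_diff_distrib)
  also have "\<dots> = h * h * D2 (p + s *\<^sub>R v + t *\<^sub>R w) w v"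
    unfolding kt using linear_cmul[OF lin2[OF inb[of s t]], of h w] s t by simp
  finally have "g h - g 0 = h * h * D2 (p + s *\<^sub>R v + t *\<^sub>R w) w v" .
  moreover have "g h - g 0 = \<phi> (p + h *\<^sub>R v + h *\<^sub>R w) - \<phi> (p + h *\<^sub>R v) - \<phi> (p + h *\<^sub>R w) + \<phi> p"
    by (simp add: g_def)
  ultimately show ?thesis
    using small[of s t] s t by auto
qed

lemma second_derivative_symmetric_real:
  fixes \<phi> :: "'a::real_normed_vector \<Rightarrow> real"
  assumes U: "open U" "p \<in> U"
    and D1: "\<And>y. y \<in> U \<Longrightarrow> (\<phi> has_derivative D\<phi> y) (at y)"
    and D2: "\<And>y v. y \<in> U \<Longrightarrow> ((\<lambda>z. D\<phi> z v) has_derivative (\<lambda>u. D2 y u v)) (at y)"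
    and cont: "\<And>u v. continuous_on U (\<lambda>y. D2 y u v)"
  shows "D2 p v w = D2 p w v"
proof (rule ccontr)
  assume ne: "D2 p v w \<noteq> D2 p w v"
  define e where "e = \<bar>D2 p v w - D2 p w v\<bar> / 2"
  have e: "e > 0" using ne by (simp add: e_def)
  obtain r where r: "r > 0" "ball p r \<subseteq> U"
    using U open_contains_ball by blast
  have "\<exists>d>0. \<forall>y. dist p y < d \<longrightarrow> \<bar>D2 y a b - D2 p a b\<bar> < e" for a b
  proof -
    have "isCont (\<lambda>y. D2 y a b) p"
      using cont U by (simp add: continuous_on_eq_continuous_at)
    then show ?thesis
      using e unfolding continuous_at_eps_delta dist_real_def by (metis dist_commute)
  qed
  then obtain d1 d2 where d: "d1 > 0" "\<And>y. dist p y < d1 \<Longrightarrow> \<bar>D2 y v w - D2 p v w\<bar> < e"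
    "d2 > 0" "\<And>y. dist p y < d2 \<Longrightarrow> \<bar>D2 y w v - D2 p w v\<bar> < e"
    by metis
  define m where "m = min r (min d1 d2)"
  define h where "h = m / (norm v + norm w + 1)"
  have m: "m > 0" using r d by (simp add: m_def)
  have n: "norm v + norm w + 1 > 0"
    by (simp add: add_nonneg_pos)
  have h: "h > 0" using m n by (simp add: h_def)
  have hm: "h * (norm v + norm w) < m"
    using m n by (simp add: h_def divide_simps)
  obtain y where y: "dist p y \<le> h * (norm v + norm w)"
    "\<phi> (p + h *\<^sub>R v + h *\<^sub>R w) - \<phi> (p + h *\<^sub>R v) - \<phi> (p + h *\<^sub>R w) + \<phi> p = h * h * D2 y w v"
    using second_difference_mean_value[where p=p and r=r and \<phi>=\<phi> and D\<phi>=D\<phi> and ?D2.0=D2 and h=h and v=v and w=w]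
      D1 D2 r h hm by (auto simp: m_def subset_iff)
  obtain z where z: "dist p z \<le> h * (norm w + norm v)"
    "\<phi> (p + h *\<^sub>R w + h *\<^sub>R v) - \<phi> (p + h *\<^sub>R w) - \<phi> (p + h *\<^sub>R v) + \<phi> p = h * h * D2 z v w"
    using second_difference_mean_value[where p=p and r=r and \<phi>=\<phi> and D\<phi>=D\<phi> and ?D2.0=D2 and h=h and v=w and w=v]
      D1 D2 r h hm by (auto simp: m_def subset_iff add.commute)
  have "h * h * D2 y w v = h * h * D2 z v w"
    using y(2) z(2) by (simp add: algebra_simps)
  then have eq: "D2 y w v = D2 z v w" using h by simp
  have "\<bar>D2 y w v - D2 p w v\<bar> < e" "\<bar>D2 z v w - D2 p v w\<bar> < e"
    using y(1) z(1) hm d by (auto simp: m_def add.commute)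
  then show False
    using eq by (auto simp: e_def abs_if field_simps split: if_splits)
qed

lemma second_derivative_symmetric:
  fixes u :: "'a::real_normed_vector \<Rightarrow> 'b::real_inner"
  assumes U: "open U" "p \<in> U"
    and D1: "\<And>y. y \<in> U \<Longrightarrow> (u has_derivative Du y) (at y)"
    and D2: "\<And>y v. y \<in> U \<Longrightarrow> ((\<lambda>z. Du z v) has_derivative (\<lambda>w. D2 y w v)) (at y)"
    and cont: "\<And>w v. continuous_on U (\<lambda>y. D2 y w v)"
  shows "D2 p v w = D2 p w v"
proof -
  have "D2 p v w \<bullet> b = D2 p w v \<bullet> b" for b
    by (rule second_derivative_symmetric_real[OF U, where \<phi>="\<lambda>y. u y \<bullet> b" and D\<phi>="\<lambda>y v. Du y v \<bullet> b"])
      (auto intro!: has_derivative_inner_left D1 D2 continuous_intros cont)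
  then show ?thesis
    by (metis inner_commute vector_eq_ldot)
qed

text \<open>The derivative of \<open>u\<close> at \<open>y\<close>.\<close>

definition D1 :: "('a::real_normed_vector \<Rightarrow> 'b::real_normed_vector) \<Rightarrow> 'a \<Rightarrow> 'a \<Rightarrow> 'b" where
  "D1 u y = frechet_derivative u (at y)"

text \<open>The second derivative of \<open>u\<close> at \<open>y\<close>; \<open>v\<close> is the direction that is differentiated last.\<close>

definition D2 :: "('a::real_normed_vector \<Rightarrow> 'b::real_normed_vector) \<Rightarrow> 'a \<Rightarrow> 'a \<Rightarrow> 'a \<Rightarrow> 'b" where
  "D2 u y v w = frechet_derivative (\<lambda>z. D1 u z w) (at y) v"

lemma smooth_on_D1:
  assumes "smooth_on U u" "open U" "y \<in> U"
  shows "(u has_derivative D1 u y) (at y)"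
proof -
  have "Ck_on (Suc 0) U u"
    using assms(1) unfolding smooth_on_def by blast
  then have "u differentiable (at y)"
    using assms by (simp add: differentiable_on_eq_differentiable_at)
  then show ?thesis
    by (simp add: D1_def frechet_derivative_works)
qed

lemma smooth_on_direction:
  assumes "smooth_on U u"
  shows "smooth_on U (\<lambda>y. D1 u y v)"
proof -
  have "Ck_on (Suc k) U u" for k
    using assms unfolding smooth_on_def by blast
  then show ?thesis
    by (simp add: smooth_on_def D1_def)
qed

lemma smooth_on_D2:
  assumes "smooth_on U u" "open U" "y \<in> U"
  shows "((\<lambda>z. D1 u z w) has_derivative (\<lambda>v. D2 u y v w)) (at y)"
  using smooth_on_D1[OF smooth_on_direction[OF assms(1), of w] assms(2,3)]
  by (simp add: D1_def D2_def)

lemma smooth_on_D2_sym: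
  fixes u :: "'a::real_normed_vector \<Rightarrow> 'b::real_inner"
  assumes "smooth_on U u" "open U" "y \<in> U"
  shows "D2 u y v w = D2 u y w v"
proof (rule second_derivative_symmetric[OF assms(2,3), where u=u and Du="D1 u"])
  show "continuous_on U (\<lambda>y. D2 u y w v)" for w v
  proof -
    have "Ck_on 0 U (\<lambda>y. D1 (\<lambda>z. D1 u z v) y w)"
      using smooth_on_direction[OF smooth_on_direction[OF assms(1)]]
      unfolding smooth_on_def by blast
    then show ?thesis
      by (simp add: D1_def D2_def)
  qed
qed (auto intro: smooth_on_D1 smooth_on_D2 assms)

lemma derivative_eq_on:
  assumes "open U" "y \<in> U" "(p has_derivative p') (at y)" "(q has_derivative q') (at y)"
    and "\<And>z. z \<in> U \<Longrightarrow> p z = q z"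
  shows "p' v = q' v"
  using has_derivative_transform_within_open[OF assms(3,1,2,5)] assms(4) has_derivative_unique
  by blast

lemma derivative_inner_const:
  fixes P Q :: "'a::real_normed_vector \<Rightarrow> 'b::real_inner"
  assumes "open U" "y \<in> U" "(P has_derivative P') (at y)" "(Q has_derivative Q') (at y)"
    and "\<And>z. z \<in> U \<Longrightarrow> P z \<bullet> Q z = c"
  shows "P' v \<bullet> Q y = - (P y \<bullet> Q' v)"
  using derivative_eq_on[OF assms(1,2) has_derivative_inner[OF assms(3,4)] has_derivative_const[of c], of v]
    assms(5) by simp

section \<open>Octonions\<close>

lemma bounded_bilinear_ocnj_omult: "bounded_bilinear (\<lambda>u v. ocnj u \<odot> v)"
  unfolding bilinear_conv_bounded_bilinear[symmetric] bilinear_def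
  by (auto intro!: linearI simp: omult_def qmult_def qcnj_def ocnj_def complex_eq_iff prod_eq_iff
      algebra_simps)

lemma inner_oct:
  "(u::oct) \<bullet> v = Re (fst (fst u)) * Re (fst (fst v)) + Im (fst (fst u)) * Im (fst (fst v))
     + Re (snd (fst u)) * Re (snd (fst v)) + Im (snd (fst u)) * Im (snd (fst v))
     + Re (fst (snd u)) * Re (fst (snd v)) + Im (fst (snd u)) * Im (fst (snd v))
     + Re (snd (snd u)) * Re (snd (snd v)) + Im (snd (snd u)) * Im (snd (snd v))"
  by (simp add: inner_prod_def inner_complex_def)

text \<open>The polarised form of \<open>u\<^sup>* u = |u|\<^sup>2\<close>.\<close>

lemma ocnj_omult_polar: "ocnj u \<odot> v + ocnj v \<odot> u = (2 * (u \<bullet> v)) *\<^sub>R oone"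
  unfolding inner_oct
  by (simp add: omult_def qmult_def qcnj_def ocnj_def oone_def complex_eq_iff prod_eq_iff
      algebra_simps)

lemma ocnj_omult_self: "ocnj u \<odot> u = (u \<bullet> u) *\<^sub>R oone"
  using ocnj_omult_polar[of u u] by (simp add: scaleR_2[symmetric] flip: scaleR_scaleR)

text \<open>The real part of \<open>u\<^sup>* v\<close> is the inner product.\<close>

lemma ocnj_omult_inner_oone: "(ocnj u \<odot> v) \<bullet> oone = u \<bullet> v"
  unfolding inner_oct
  by (simp add: omult_def qmult_def qcnj_def ocnj_def oone_def algebra_simps)

section \<open>Orthonormal bases, traces and linear systems\<close>

lemma vec_expansion: "(\<Sum>k\<in>UNIV. v $ k *\<^sub>R axis k 1) = (v :: real^'n)"
  using basis_expansion[of v] by (simp add: scalar_mult_eq_scaleR)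

lemma trace_matrix_mult_commute: "trace (A ** B) = trace (B ** (A :: real^'n^'n))"
  unfolding trace_def matrix_matrix_mult_def vec_lambda_beta
  by (subst sum.swap) (simp add: mult.commute)

lemma linear_vec_expansion:
  fixes L :: "real^'n \<Rightarrow> 'b::real_vector"
  assumes "linear L"
  shows "L v = (\<Sum>k\<in>UNIV. v $ k *\<^sub>R L (axis k 1))"
proof -
  have "L (\<Sum>k\<in>UNIV. v $ k *\<^sub>R axis k 1) = (\<Sum>k\<in>UNIV. v $ k *\<^sub>R L (axis k 1))"
    using assms by (simp add: linear_sum linear_cmul)
  then show ?thesis by (simp only: vec_expansion)
qed

lemma bilinear_vec_expansion:
  fixes b :: "real^'n \<Rightarrow> real^'n \<Rightarrow> 'b::real_vector"
  assumes "\<And>v. linear (\<lambda>u. b u v)" "\<And>u. linear (b u)"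
  shows "b u v = (\<Sum>i\<in>UNIV. \<Sum>j\<in>UNIV. (u $ i * v $ j) *\<^sub>R b (axis i 1) (axis j 1))"
proof -
  have "b u v = (\<Sum>i\<in>UNIV. u $ i *\<^sub>R b (axis i 1) v)"
    by (rule linear_vec_expansion[OF assms(1)])
  also have "\<dots> = (\<Sum>i\<in>UNIV. \<Sum>j\<in>UNIV. (u $ i * v $ j) *\<^sub>R b (axis i 1) (axis j 1))"
    by (subst linear_vec_expansion[OF assms(2)]) (simp add: scaleR_sum_right)
  finally show ?thesis .
qed

lemma orthonormal_basis_finite:
  fixes W :: "'a::euclidean_space set"
  assumes "orthonormal_basis W S"
  shows "finite W" "b \<in> W \<Longrightarrow> c \<in> W \<Longrightarrow> b \<bullet> c = (if b = c then 1 else 0)" "W \<subseteq> S"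
proof -
  have "pairwise orthogonal W" "0 \<notin> W"
    using assms(1) by (force simp: orthonormal_basis_def)+
  then show "finite W"
    by (simp add: pairwise_orthogonal_imp_finite)
  show "b \<in> W \<Longrightarrow> c \<in> W \<Longrightarrow> b \<bullet> c = (if b = c then 1 else 0)"
    using assms by (auto simp: orthonormal_basis_def pairwise_def orthogonal_def norm_eq_1)
  show "W \<subseteq> S"
    using assms span_superset by (auto simp: orthonormal_basis_def)
qed

lemma orthonormal_expansion:
  fixes v :: "'a::euclidean_space"
  assumes "orthonormal_basis W S" "v \<in> S"
  shows "(\<Sum>w\<in>W. (v \<bullet> w) *\<^sub>R w) = v"
proof -
  note W = orthonormal_basis_finite[OF assms(1)]
  have "v \<in> span W"
    using assms by (simp add: orthonormal_basis_def)
  then obtain a where a: "v = (\<Sum>w\<in>W. a w *\<^sub>R w)"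
    using span_finite[OF W(1)] by auto
  have "v \<bullet> c = a c" if "c \<in> W" for c
  proof -
    have "v \<bullet> c = (\<Sum>w\<in>W. if w = c then a w else 0)"
      unfolding a inner_sum_left by (rule sum.cong) (auto simp: W(2) that)
    also have "\<dots> = a c"
      using W(1) that by simp
    finally show ?thesis .
  qed
  then show ?thesis
    using a by simp
qed

lemma orthonormal_basis_exists:
  fixes D :: "'a::euclidean_space \<Rightarrow> 'b::euclidean_space"
  assumes "linear D" "inj D"
  obtains W where "orthonormal_basis W (range D)" "card W = DIM('a)"
proof -
  have "subspace (range D)"
    using assms linear_subspace_image subspace_UNIV by blast
  then obtain W where W: "pairwise orthogonal W" "\<And>x. x \<in> W \<Longrightarrow> norm x = 1"
    "card W = dim (range D)" "span W = range D"
    by (rule orthonormal_basis_subspace) blast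
  have "dim (range D) = DIM('a)"
    using dim_image_eq[OF assms(1), of UNIV] assms(2) by simp
  with W show thesis
    by (intro that[of W]) (auto simp: orthonormal_basis_def)
qed

text \<open>The trace of the coordinate expression of an endomorphism of the range of an injective \<open>D\<close>,
  computed in an orthonormal basis of that range.\<close>

lemma trace_frame:
  fixes D :: "real^'n \<Rightarrow> 'b::euclidean_space" and \<phi> :: "real^'n \<Rightarrow> real^'n"
  assumes D: "linear D" "inj D" and W: "orthonormal_basis W (range D)" and \<phi>: "linear \<phi>"
  shows "trace (matrix \<phi>) = (\<Sum>w\<in>W. D (\<phi> (inv D w)) \<bullet> w)"
proof -
  have DL: "D (inv D w) = w" if "w \<in> W" for w
    using orthonormal_basis_finite(3)[OF W] that by (auto simp: f_inv_into_f)
  have "axis k 1 = (\<Sum>w\<in>W. (D (axis k 1) \<bullet> w) *\<^sub>R inv D w)" (is "_ = ?r") for k :: 'n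
  proof -
    have "D ?r = (\<Sum>w\<in>W. (D (axis k 1) \<bullet> w) *\<^sub>R w)"
      using D(1) by (simp add: linear_sum linear_cmul DL cong: sum.cong)
    also have "\<dots> = D (axis k 1)"
      by (rule orthonormal_expansion[OF W]) simp
    finally show ?thesis
      using D(2) by (metis injD)
  qed
  then have "\<phi> (axis k 1) = (\<Sum>w\<in>W. (D (axis k 1) \<bullet> w) *\<^sub>R \<phi> (inv D w))" for k
    using \<phi> by (metis (no_types, lifting) linear_cmul linear_sum sum.cong)
  then have "trace (matrix \<phi>) = (\<Sum>k\<in>UNIV. \<Sum>w\<in>W. (D (axis k 1) \<bullet> w) * \<phi> (inv D w) $ k)"
    by (simp add: trace_def matrix_def)
  also have "\<dots> = (\<Sum>w\<in>W. \<Sum>k\<in>UNIV. (D (axis k 1) \<bullet> w) * \<phi> (inv D w) $ k)"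
    by (rule sum.swap)
  also have "\<dots> = (\<Sum>w\<in>W. D (\<Sum>k\<in>UNIV. \<phi> (inv D w) $ k *\<^sub>R axis k 1) \<bullet> w)"
    using D(1) by (simp add: linear_sum linear_cmul inner_sum_left mult.commute)
  also have "\<dots> = (\<Sum>w\<in>W. D (\<phi> (inv D w)) \<bullet> w)"
    by (simp only: vec_expansion)
  finally show ?thesis .
qed

text \<open>Cramer's rule makes the solution of a linear system as regular as its coefficients.\<close>

lemma differentiable_det:
  fixes G :: "'a::real_normed_vector \<Rightarrow> real^'n^'n"
  assumes "\<And>i j. (\<lambda>z. G z $ i $ j) differentiable at y"
  shows "(\<lambda>z. det (G z)) differentiable at y"
proof -
  have "(\<lambda>z. \<Prod>i\<in>UNIV. G z $ i $ p i) differentiable at y" for p :: "'n \<Rightarrow> 'n"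
  proof -
    have "((\<lambda>z. G z $ i $ p i) has_derivative frechet_derivative (\<lambda>z. G z $ i $ p i) (at y)) (at y)" for i
      using assms by (simp add: frechet_derivative_works)
    then show ?thesis
      by (intro differentiableI[OF has_derivative_prod])
  qed
  then show ?thesis
    unfolding det_def by (intro differentiable_sum differentiable_mult) auto
qed

lemma differentiable_vec_nth:
  fixes \<xi> :: "'a::real_normed_vector \<Rightarrow> real^'n"
  assumes "\<And>k. (\<lambda>z. \<xi> z $ k) differentiable at y"
  shows "\<xi> differentiable at y"
proof -
  have "(\<lambda>z. \<Sum>k\<in>UNIV. \<xi> z $ k *\<^sub>R (axis k 1 :: real^'n)) differentiable at y"
    using assms by (intro differentiable_sum differentiable_scaleR) auto
  then show ?thesis
    by (simp only: vec_expansion)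
qed

lemma differentiable_linear_solution:
  fixes G :: "'a::real_normed_vector \<Rightarrow> real^'n^'n" and \<xi> r :: "'a \<Rightarrow> real^'n"
  assumes U: "open U" "y \<in> U"
    and G: "\<And>i j. (\<lambda>z. G z $ i $ j) differentiable at y"
    and r: "\<And>i. (\<lambda>z. r z $ i) differentiable at y"
    and det: "\<And>z. z \<in> U \<Longrightarrow> det (G z) \<noteq> 0"
    and eq: "\<And>z. z \<in> U \<Longrightarrow> G z *v \<xi> z = r z"
  shows "\<xi> differentiable at y"
proof -
  define s where "s z = (\<chi> k. det (\<chi> i j. if j = k then r z $ i else G z $ i $ j) / det (G z))" for z
  have "(\<lambda>z. if j = k then r z $ i else G z $ i $ j) differentiable at y" for i j k
    by (cases "j = k") (simp_all add: G r)
  then have "(\<lambda>z. s z $ k) differentiable at y" for k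
    unfolding s_def vec_lambda_beta
    using U det by (intro differentiable_divide differentiable_det) (auto simp: G r)
  then have "s differentiable at y"
    by (rule differentiable_vec_nth)
  moreover have "s z = \<xi> z" if "z \<in> U" for z
    using cramer[OF det[OF that]] eq[OF that] by (simp add: s_def)
  ultimately show ?thesis
    using U by (metis differentiable_def has_derivative_transform_within_open)
qed

section \<open>Local geometry of a hypersurface of the sphere\<close>

text \<open>A parametrised piece of hypersurface: an immersion \<open>F\<close> of an open subset of \<open>\<real>\<^sup>6\<close> into the unit
  sphere of \<open>\<real>\<^sup>8\<close> and a unit normal field \<open>N\<close>, tangent to the sphere.\<close>

locale hypersurface_patch =
  fixes U :: "(real^6) set" and F N :: "real^6 \<Rightarrow> oct"
  assumes open_U: "open U"
    and smooth_F: "smooth_on U F"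
    and smooth_N: "smooth_on U N"
    and immersion: "y \<in> U \<Longrightarrow> inj (D1 F y)"
    and unit_F: "y \<in> U \<Longrightarrow> F y \<bullet> F y = 1"
    and unit_N: "y \<in> U \<Longrightarrow> N y \<bullet> N y = 1"
    and N_F: "y \<in> U \<Longrightarrow> N y \<bullet> F y = 0"
    and N_tangent: "y \<in> U \<Longrightarrow> N y \<bullet> D1 F y v = 0"
begin

lemmas F1 = smooth_on_D1[OF smooth_F open_U]
lemmas N1 = smooth_on_D1[OF smooth_N open_U]
lemmas F2 = smooth_on_D2[OF smooth_F open_U]
lemmas N2 = smooth_on_D2[OF smooth_N open_U]
lemmas F2_sym = smooth_on_D2_sym[OF smooth_F open_U]
lemmas N2_sym = smooth_on_D2_sym[OF smooth_N open_U]

lemma linear_F1: "y \<in> U \<Longrightarrow> linear (D1 F y)"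
  using F1 has_derivative_linear by blast

lemma linear_N1: "y \<in> U \<Longrightarrow> linear (D1 N y)"
  using N1 has_derivative_linear by blast

lemma linear_F2:
  assumes "y \<in> U"
  shows "linear (\<lambda>u. D2 F y u v)" "linear (D2 F y u)"
proof -
  show l: "linear (\<lambda>u. D2 F y u v)" for v
    using F2[OF assms] has_derivative_linear by blast
  show "linear (D2 F y u)"
  proof -
    have "D2 F y u = (\<lambda>v. D2 F y v u)"
      by (rule ext) (rule F2_sym[OF assms])
    then show ?thesis
      using l[of u] by simp
  qed
qed

lemma linear_N2:
  assumes "y \<in> U"
  shows "linear (\<lambda>u. D2 N y u v)" "linear (D2 N y u)"
proof -
  show l: "linear (\<lambda>u. D2 N y u v)" for v
    using N2[OF assms] has_derivative_linear by blast
  show "linear (D2 N y u)"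
  proof -
    have "D2 N y u = (\<lambda>v. D2 N y v u)"
      by (rule ext) (rule N2_sym[OF assms])
    then show ?thesis
      using l[of u] by simp
  qed
qed

lemma F1_N: "y \<in> U \<Longrightarrow> D1 F y v \<bullet> N y = 0"
  by (simp add: inner_commute N_tangent)

lemma F1_F: "y \<in> U \<Longrightarrow> D1 F y v \<bullet> F y = 0"
  using derivative_inner_const[OF open_U _ F1 F1 unit_F, of y v] by (simp add: inner_commute)

lemma N1_N: "y \<in> U \<Longrightarrow> D1 N y v \<bullet> N y = 0"
  using derivative_inner_const[OF open_U _ N1 N1 unit_N, of y v] by (simp add: inner_commute)

lemma N1_F: "y \<in> U \<Longrightarrow> D1 N y v \<bullet> F y = 0"
  using derivative_inner_const[OF open_U _ N1 F1 N_F, of y v] N_tangent by simp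

lemma F2_F: "y \<in> U \<Longrightarrow> D2 F y u v \<bullet> F y = - (D1 F y v \<bullet> D1 F y u)"
  by (rule derivative_inner_const[OF open_U _ F2 F1 F1_F])

lemma F2_N: "y \<in> U \<Longrightarrow> D2 F y u v \<bullet> N y = - (D1 N y u \<bullet> D1 F y v)"
  using derivative_inner_const[OF open_U _ F2 N1 F1_N] by (simp add: inner_commute)

lemma N2_F: "y \<in> U \<Longrightarrow> D2 N y u v \<bullet> F y = - (D1 N y v \<bullet> D1 F y u)"
  by (rule derivative_inner_const[OF open_U _ N2 F1 N1_F])

lemma N2_N: "y \<in> U \<Longrightarrow> D2 N y u v \<bullet> N y = - (D1 N y v \<bullet> D1 N y u)"
  by (rule derivative_inner_const[OF open_U _ N2 N1 N1_N])

text \<open>The second fundamental form is symmetric.\<close>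

lemma N1_F1_sym: "y \<in> U \<Longrightarrow> D1 N y u \<bullet> D1 F y v = D1 N y v \<bullet> D1 F y u"
  using F2_N[of y u v] F2_N[of y v u] F2_sym[of y u v] by simp

text \<open>The Codazzi equation: the derivative of this symmetry.\<close>

lemma codazzi:
  assumes "y \<in> U"
  shows "D2 N y z u \<bullet> D1 F y v + D1 N y u \<bullet> D2 F y z v = D2 N y z v \<bullet> D1 F y u + D1 N y v \<bullet> D2 F y z u"
proof -
  have "D1 N y u \<bullet> D2 F y z v + D2 N y z u \<bullet> D1 F y v = D1 N y v \<bullet> D2 F y z u + D2 N y z v \<bullet> D1 F y u"
    by (rule derivative_eq_on[OF open_U assms has_derivative_inner[OF N2 F2] has_derivative_inner[OF N2 F2]])
      (use N1_F1_sym assms in auto)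
  then show ?thesis by simp
qed

text \<open>The position vector, the normal and the tangent space span \<open>\<real>\<^sup>8\<close>.\<close>

lemma eq_0_if_orthogonal:
  assumes y: "y \<in> U" and v: "v \<bullet> F y = 0" "v \<bullet> N y = 0" "\<And>w. v \<bullet> D1 F y w = 0"
  shows "v = 0"
proof (rule ccontr)
  assume "v \<noteq> 0"
  obtain W where W: "orthonormal_basis W (range (D1 F y))" "card W = DIM(real^6)"
    using orthonormal_basis_exists[OF linear_F1[OF y] immersion[OF y]] by blast
  note fin = orthonormal_basis_finite[OF W(1)]
  have o: "b \<bullet> F y = 0" "b \<bullet> N y = 0" "b \<bullet> v = 0" if "b \<in> W" for b
    using that fin(3) v(3) F1_F[OF y] N_tangent[OF y] by (auto simp: inner_commute)
  have nz: "F y \<noteq> 0" "N y \<noteq> 0" "0 \<notin> W"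
    using unit_F[OF y] unit_N[OF y] fin(2)[of 0 0] by auto
  have ni: "F y \<notin> W" "N y \<notin> W" "v \<notin> W" "F y \<noteq> N y" "F y \<noteq> v" "N y \<noteq> v"
    using o[of "F y"] o[of "N y"] o[of v] unit_F[OF y] unit_N[OF y] v N_F[OF y] \<open>v \<noteq> 0\<close> by auto
  \<comment> \<open>nine nonzero orthogonal vectors in \<open>\<real>\<^sup>8\<close>\<close>
  define S where "S = insert v (insert (F y) (insert (N y) W))"
  have "pairwise orthogonal S"
    using W(1) o v N_F[OF y]
    by (auto simp: S_def pairwise_insert orthogonal_def orthonormal_basis_def inner_commute)
  moreover have "0 \<notin> S"
    using nz \<open>v \<noteq> 0\<close> by (auto simp: S_def)
  ultimately have "independent S"
    by (rule pairwise_orthogonal_independent)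
  then have "card S \<le> DIM(oct)"
    using independent_bound by blast
  moreover have "card S = 9"
    using ni fin(1) W(2) by (simp add: S_def)
  ultimately show False by simp
qed

lemma tangent_if_orthogonal:
  assumes y: "y \<in> U" and v: "v \<bullet> F y = 0" "v \<bullet> N y = 0"
  shows "v \<in> range (D1 F y)"
proof -
  obtain W where W: "orthonormal_basis W (range (D1 F y))"
    using orthonormal_basis_exists[OF linear_F1[OF y] immersion[OF y]] by blast
  note fin = orthonormal_basis_finite[OF W]
  define t where "t = (\<Sum>b\<in>W. (v \<bullet> b) *\<^sub>R b)"
  have sub: "subspace (range (D1 F y))"
    using linear_F1[OF y] linear_subspace_image subspace_UNIV by blast
  have t: "t \<in> range (D1 F y)"
    unfolding t_def using fin(3) by (intro subspace_sum[OF sub] subspace_scale[OF sub]) auto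
  have "v - t = 0"
  proof (rule eq_0_if_orthogonal[OF y])
    obtain s where "t = D1 F y s"
      using t by blast
    then show "(v - t) \<bullet> F y = 0" "(v - t) \<bullet> N y = 0"
      using v by (simp_all add: inner_diff_left F1_F F1_N y)
    have tb: "t \<bullet> c = v \<bullet> c" if "c \<in> range (D1 F y)" for c
    proof -
      have "t \<bullet> c = v \<bullet> (\<Sum>b\<in>W. (c \<bullet> b) *\<^sub>R b)"
        by (simp add: t_def inner_sum_left inner_sum_right mult.commute inner_commute[of c])
      also have "\<dots> = v \<bullet> c"
        by (simp only: orthonormal_expansion[OF W that])
      finally show ?thesis .
    qed
    show "(v - t) \<bullet> D1 F y w = 0" for w
      by (simp add: inner_diff_left tb)
  qed
  then show ?thesis using t by simp
qed

lemma N1_tangent: "y \<in> U \<Longrightarrow> D1 N y v \<in> range (D1 F y)"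
  by (simp add: tangent_if_orthogonal N1_F N1_N)

text \<open>The matrix of the induced metric.\<close>

definition gram :: "real^6 \<Rightarrow> real^6^6" where
  "gram z = (\<chi> i j. D1 F z (axis i 1) \<bullet> D1 F z (axis j 1))"

lemma gram_mult:
  assumes "z \<in> U"
  shows "(gram z *v x) $ i = D1 F z (axis i 1) \<bullet> D1 F z x"
proof -
  have "(gram z *v x) $ i = D1 F z (axis i 1) \<bullet> (\<Sum>j\<in>UNIV. x $ j *\<^sub>R D1 F z (axis j 1))"
    by (simp add: gram_def matrix_vector_mult_def inner_sum_right mult.commute)
  then show ?thesis
    by (simp only: linear_vec_expansion[OF linear_F1[OF assms], of x])
qed

lemma invertible_gram:
  assumes z: "z \<in> U"
  shows "invertible (gram z)"
proof -
  have "x = 0" if "gram z *v x = 0" for x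
  proof -
    have "D1 F z (\<Sum>i\<in>UNIV. x $ i *\<^sub>R axis i 1) \<bullet> D1 F z x = (\<Sum>i\<in>UNIV. x $ i * (gram z *v x) $ i)"
      using linear_F1[OF z] by (simp add: linear_sum linear_cmul inner_sum_left gram_mult[OF z])
    then have "D1 F z x = 0"
      using that by (simp add: vec_expansion)
    then show "x = 0"
      using immersion[OF z] linear_F1[OF z] by (metis injD linear_0)
  qed
  then show ?thesis
    by (metis invertible_left_inverse matrix_left_invertible_ker)
qed

text \<open>A coordinate field given by its metric pairings is differentiable if the pairings are.\<close>

lemma metric_solution_differentiable:
  assumes y: "y \<in> U"
    and \<xi>: "\<And>z v. z \<in> U \<Longrightarrow> D1 F z (\<xi> z) \<bullet> D1 F z v = r z v"
    and r: "\<And>v. (\<lambda>z. r z v) differentiable at y"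
  shows "\<xi> differentiable at y"
proof (rule differentiable_linear_solution[OF open_U y])
  show "(\<lambda>z. gram z $ i $ j) differentiable at y" for i j
    using has_derivative_inner[OF F2 F2, OF y y] by (auto simp: gram_def differentiable_def)
  show "(\<lambda>z. (\<chi> i. r z (axis i 1)) $ i) differentiable at y" for i
    using r by simp
  show "gram z *v \<xi> z = (\<chi> i. r z (axis i 1))" if "z \<in> U" for z
    using that by (simp add: vec_eq_iff gram_mult \<xi>[symmetric] inner_commute)
  show "det (gram z) \<noteq> 0" if "z \<in> U" for z
    using invertible_gram[OF that] by (simp add: invertible_det_nz)
qed

text \<open>Every linear functional on coordinate vectors is represented by the induced metric.\<close>

lemma riesz:
  assumes y: "y \<in> U" and l: "linear l"
  shows "\<exists>\<xi>. \<forall>v. D1 F y \<xi> \<bullet> D1 F y v = l v"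
proof -
  define s where "s = (\<chi> i. l (axis i 1))"
  obtain C where C: "gram y ** C = mat 1"
    using invertible_gram[OF y] invertible_def by blast
  define \<xi> where "\<xi> = C *v s"
  have G: "gram y *v \<xi> = s"
    by (simp add: \<xi>_def matrix_vector_mul_assoc C)
  have "D1 F y \<xi> \<bullet> D1 F y v = l v" for v
  proof -
    have "D1 F y \<xi> \<bullet> D1 F y (\<Sum>i\<in>UNIV. v $ i *\<^sub>R axis i 1) = (\<Sum>i\<in>UNIV. v $ i * (gram y *v \<xi>) $ i)"
      using linear_F1[OF y] by (simp add: linear_sum linear_cmul inner_sum_right gram_mult[OF y] inner_commute)
    also have "\<dots> = l (\<Sum>i\<in>UNIV. v $ i *\<^sub>R axis i 1)"
      using l by (simp add: G s_def linear_sum linear_cmul)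
    finally show ?thesis
      by (simp only: vec_expansion)
  qed
  then show ?thesis by blast
qed

lemma has_derivative_F1_field:
  assumes y: "y \<in> U" and \<xi>: "(\<xi> has_derivative \<xi>') (at y)"
  shows "((\<lambda>z. D1 F z (\<xi> z)) has_derivative (\<lambda>v. D2 F y v (\<xi> y) + D1 F y (\<xi>' v))) (at y)"
proof -
  have "((\<lambda>z. \<Sum>k\<in>UNIV. \<xi> z $ k *\<^sub>R D1 F z (axis k 1)) has_derivative
      (\<lambda>v. \<Sum>k\<in>UNIV. \<xi> y $ k *\<^sub>R D2 F y v (axis k 1) + \<xi>' v $ k *\<^sub>R D1 F y (axis k 1))) (at y)"
    by (intro has_derivative_sum has_derivative_scaleR F2 y bounded_linear.has_derivative[OF bounded_linear_vec_nth \<xi>])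
  then have "((\<lambda>z. \<Sum>k\<in>UNIV. \<xi> z $ k *\<^sub>R D1 F z (axis k 1)) has_derivative
      (\<lambda>v. D2 F y v (\<xi> y) + D1 F y (\<xi>' v))) (at y)"
    by (simp add: sum.distrib flip: linear_vec_expansion[OF linear_F2(2)[OF y]] linear_vec_expansion[OF linear_F1[OF y]])
  then show ?thesis
    by (rule has_derivative_transform_within_open[OF _ open_U y]) (rule linear_vec_expansion[OF linear_F1, symmetric])
qed

end

section \<open>Laplacians in an orthonormal frame\<close>

text \<open>A point \<open>p\<close> of the patch and an orthonormal basis \<open>W\<close> of the tangent space there. Contractions with
  the inverse metric at \<open>p\<close> become sums over \<open>W\<close>.\<close>

locale hypersurface_frame = hypersurface_patch +
  fixes p :: "real^6" and W :: "oct set"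
  assumes p: "p \<in> U"
    and W: "orthonormal_basis W (range (D1 F p))" "card W = 6"
begin

text \<open>The coordinate vector of a tangent vector at \<open>p\<close>.\<close>

definition e :: "oct \<Rightarrow> real^6" where
  "e = inv (D1 F p)"

lemmas W_finite = orthonormal_basis_finite(1)[OF W(1)]
lemmas W_inner = orthonormal_basis_finite(2)[OF W(1)]
lemmas W_expansion = orthonormal_expansion[OF W(1)]

lemma W_inner_expansion:
  assumes "v \<in> range (D1 F p)"
  shows "(\<Sum>w\<in>W. (u \<bullet> w) * (v \<bullet> w)) = u \<bullet> v"
proof -
  have "(\<Sum>w\<in>W. (u \<bullet> w) * (v \<bullet> w)) = u \<bullet> (\<Sum>w\<in>W. (v \<bullet> w) *\<^sub>R w)"
    by (simp add: inner_sum_right mult.commute)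
  then show ?thesis
    by (simp add: W_expansion assms)
qed

lemma F1_e: "w \<in> W \<Longrightarrow> D1 F p (e w) = w"
  using orthonormal_basis_finite(3)[OF W(1)] by (auto simp: e_def f_inv_into_f)

lemma e_F1: "e (D1 F p v) = v"
  by (simp add: e_def immersion p)

text \<open>The coordinate vector of the tangential part of the second derivative of the immersion in
  the direction \<open>w\<close>.\<close>

definition corr :: "oct \<Rightarrow> real^6" where
  "corr w = (\<Sum>b\<in>W. (D2 F p (e w) (e w) \<bullet> b) *\<^sub>R e b)"

lemma F1_corr:
  assumes "v \<in> range (D1 F p)"
  shows "D1 F p (corr w) \<bullet> v = D2 F p (e w) (e w) \<bullet> v"
proof -
  have "D1 F p (corr w) = (\<Sum>b\<in>W. (D2 F p (e w) (e w) \<bullet> b) *\<^sub>R b)"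
    using linear_F1[OF p] by (simp add: corr_def linear_sum linear_cmul F1_e cong: sum.cong)
  then show ?thesis
    using W_inner_expansion[OF assms, of "D2 F p (e w) (e w)"]
    by (simp add: inner_sum_left inner_sum_right inner_commute)
qed

text \<open>The Laplacian at \<open>p\<close> of a map with first derivative \<open>A\<close> and second derivative \<open>B\<close> there: the
  trace over \<open>W\<close> of its Hessian. Taking the derivatives as arguments makes it linear in them and
  applies to real and to vector-valued maps.\<close>

definition lap :: "(real^6 \<Rightarrow> 'b::real_vector) \<Rightarrow> (real^6 \<Rightarrow> real^6 \<Rightarrow> 'b) \<Rightarrow> 'b" where
  "lap A B = (\<Sum>w\<in>W. B (e w) (e w) - A (corr w))"

text \<open>The trace of the shape operator \<open>A = - dN\<close> at \<open>p\<close>, the trace of \<open>A\<^sup>2\<close> (the sum of the \<open>|A w|\<^sup>2\<close>, as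
  \<open>A\<close> is symmetric), and the derivative of \<open>tr A\<close> in the coordinate direction \<open>z\<close>.\<close>

definition tr_shape :: real where
  "tr_shape = - (\<Sum>w\<in>W. D1 N p (e w) \<bullet> w)"

definition shape_sq :: real where
  "shape_sq = (\<Sum>w\<in>W. D1 N p (e w) \<bullet> D1 N p (e w))"

definition tr_shape_deriv :: "real^6 \<Rightarrow> real" where
  "tr_shape_deriv z = (\<Sum>w\<in>W. D1 N p (e w) \<bullet> D2 F p z (e w) - D2 N p z (e w) \<bullet> w)"

text \<open>The position vector has Laplacian \<open>(tr A) N - 6 F\<close>.\<close>

lemma lap_F: "lap (D1 F p) (D2 F p) = tr_shape *\<^sub>R N p - 6 *\<^sub>R F p"
proof -
  have "lap (D1 F p) (D2 F p) - (tr_shape *\<^sub>R N p - 6 *\<^sub>R F p) = 0"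
  proof (rule eq_0_if_orthogonal[OF p])
    have "lap (D1 F p) (D2 F p) \<bullet> F p = (\<Sum>w\<in>W. - 1)"
      unfolding lap_def inner_sum_left
      by (rule sum.cong) (auto simp: inner_diff_left F2_F F1_F p F1_e W_inner)
    then show "(lap (D1 F p) (D2 F p) - (tr_shape *\<^sub>R N p - 6 *\<^sub>R F p)) \<bullet> F p = 0"
      using W(2) by (simp add: inner_diff_left unit_F N_F p)
    have "lap (D1 F p) (D2 F p) \<bullet> N p = (\<Sum>w\<in>W. - (D1 N p (e w) \<bullet> w))"
      unfolding lap_def inner_sum_left
      by (rule sum.cong) (simp_all add: inner_diff_left F2_N F1_N p F1_e)
    then show "(lap (D1 F p) (D2 F p) - (tr_shape *\<^sub>R N p - 6 *\<^sub>R F p)) \<bullet> N p = 0"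
      using unit_N[OF p] N_F[OF p]
      by (simp add: inner_diff_left tr_shape_def sum_negf inner_commute[of "F p"])
    show "(lap (D1 F p) (D2 F p) - (tr_shape *\<^sub>R N p - 6 *\<^sub>R F p)) \<bullet> D1 F p v = 0" for v
      using F1_F[OF p, of v] N_tangent[OF p, of v]
      by (simp add: lap_def inner_diff_left inner_sum_left F1_corr inner_commute[of "F p"])
  qed
  then show ?thesis by simp
qed

text \<open>The normal has Laplacian \<open>(tr A) F - |A|\<^sup>2 N - grad (tr A)\<close>; its tangential part comes from the
  Codazzi equation.\<close>

lemma lap_N:
  assumes g: "g \<in> range (D1 F p)" "\<And>z. g \<bullet> D1 F p z = tr_shape_deriv z"
  shows "lap (D1 N p) (D2 N p) = tr_shape *\<^sub>R F p - shape_sq *\<^sub>R N p - g"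
proof -
  have gF: "g \<bullet> F p = 0" "g \<bullet> N p = 0"
    using g(1) F1_F[OF p] N_tangent[OF p] by (auto simp: inner_commute)
  have "lap (D1 N p) (D2 N p) - (tr_shape *\<^sub>R F p - shape_sq *\<^sub>R N p - g) = 0"
  proof (rule eq_0_if_orthogonal[OF p])
    have "lap (D1 N p) (D2 N p) \<bullet> F p = tr_shape"
      unfolding lap_def inner_sum_left tr_shape_def sum_negf[symmetric]
      by (rule sum.cong) (auto simp: inner_diff_left N2_F N1_F p F1_e)
    then show "(lap (D1 N p) (D2 N p) - (tr_shape *\<^sub>R F p - shape_sq *\<^sub>R N p - g)) \<bullet> F p = 0"
      by (simp add: inner_diff_left unit_F N_F p gF)
    have "lap (D1 N p) (D2 N p) \<bullet> N p = - shape_sq"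
      unfolding lap_def inner_sum_left shape_sq_def sum_negf[symmetric]
      by (rule sum.cong) (auto simp: inner_diff_left N2_N N1_N p)
    then show "(lap (D1 N p) (D2 N p) - (tr_shape *\<^sub>R F p - shape_sq *\<^sub>R N p - g)) \<bullet> N p = 0"
      using N_F[OF p] by (simp add: inner_diff_left unit_N p gF inner_commute[of "F p"])
    show "(lap (D1 N p) (D2 N p) - (tr_shape *\<^sub>R F p - shape_sq *\<^sub>R N p - g)) \<bullet> D1 F p v = 0" for v
    proof -
      have "(D2 N p (e w) (e w) - D1 N p (corr w)) \<bullet> D1 F p v
          = - (D1 N p (e w) \<bullet> D2 F p v (e w) - D2 N p v (e w) \<bullet> w)"
        if "w \<in> W" for w
      proof -
        \<comment> \<open>this term cancels a term of the Codazzi equation\<close>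
        have "D1 N p (corr w) \<bullet> D1 F p v = D1 N p v \<bullet> D2 F p (e w) (e w)"
          using F1_corr[OF N1_tangent[OF p]] N1_F1_sym[OF p] by (metis inner_commute)
        then show ?thesis
          using codazzi[OF p, of "e w" "e w" v] that
          by (simp add: inner_diff_left F1_e F2_sym[OF p, of v] N2_sym[OF p, of v])
      qed
      then have "lap (D1 N p) (D2 N p) \<bullet> D1 F p v = - tr_shape_deriv v"
        unfolding lap_def inner_sum_left tr_shape_deriv_def sum_negf[symmetric]
        by (rule sum.cong[OF refl])
      then show ?thesis
        using F1_F[OF p, of v] N_tangent[OF p, of v]
        by (simp add: inner_diff_left g(2) inner_commute[of "F p"])
    qed
  qed
  then show ?thesis by simp
qed

text \<open>The cross term in the Laplacian of \<open>F\<^sup>* N\<close> is real: the second fundamental form is symmetric,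
  so only the symmetric part of the product \<open>w\<^sup>* b\<close>, a multiple of the unit, contributes.\<close>

lemma sum_ocnj_omult_N1: "(\<Sum>w\<in>W. ocnj w \<odot> D1 N p (e w)) = (- tr_shape) *\<^sub>R oone"
proof -
  interpret bounded_bilinear "\<lambda>u v. ocnj u \<odot> v"
    by (rule bounded_bilinear_ocnj_omult)
  define h where "h w b = D1 N p (e w) \<bullet> b" for w b
  have h: "h w b = h b w" if "w \<in> W" "b \<in> W" for w b
    using N1_F1_sym[OF p, of "e w" "e b"] that by (simp add: h_def F1_e)
  define S where "S = (\<Sum>w\<in>W. \<Sum>b\<in>W. h w b *\<^sub>R (ocnj w \<odot> b))"
  have "(\<Sum>w\<in>W. ocnj w \<odot> D1 N p (e w)) = S"
    unfolding S_def
  proof (rule sum.cong[OF refl])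
    fix w assume "w \<in> W"
    have "ocnj w \<odot> D1 N p (e w) = ocnj w \<odot> (\<Sum>b\<in>W. h w b *\<^sub>R b)"
      unfolding h_def by (simp add: W_expansion N1_tangent p)
    then show "ocnj w \<odot> D1 N p (e w) = (\<Sum>b\<in>W. h w b *\<^sub>R (ocnj w \<odot> b))"
      by (simp add: sum_right scaleR_right)
  qed
  moreover have "2 *\<^sub>R S = (- 2 * tr_shape) *\<^sub>R oone"
  proof -
    have "S = (\<Sum>w\<in>W. \<Sum>b\<in>W. h w b *\<^sub>R (ocnj b \<odot> w))"
      unfolding S_def by (subst sum.swap) (auto intro!: sum.cong simp: h)
    then have "2 *\<^sub>R S = (\<Sum>w\<in>W. \<Sum>b\<in>W. h w b *\<^sub>R (ocnj w \<odot> b + ocnj b \<odot> w))"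
      by (simp add: scaleR_2 scaleR_add_right sum.distrib S_def)
    also have "\<dots> = (\<Sum>w\<in>W. \<Sum>b\<in>W. if w = b then (2 * h w w) *\<^sub>R oone else 0)"
      by (intro sum.cong refl) (auto simp: ocnj_omult_polar W_inner)
    also have "\<dots> = (\<Sum>w\<in>W. (2 * h w w) *\<^sub>R oone)"
      using W_finite by (intro sum.cong refl) simp
    also have "\<dots> = (- 2 * tr_shape) *\<^sub>R oone"
      by (simp add: tr_shape_def h_def scaleR_sum_left[symmetric] sum_distrib_left sum_negf)
    finally show ?thesis .
  qed
  then have "S = (- tr_shape) *\<^sub>R oone"
    by (metis (no_types) scaleR_cancel_left scaleR_scaleR mult_minus_left mult_minus_right zero_neq_numeral)
  ultimately show ?thesis by simp
qed

text \<open>The Leibniz rule for the Laplacian of \<open>F\<^sup>* N\<close>; the multiples of the unit that involve \<open>tr A\<close>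
  cancel.\<close>

lemma lap_gauss:
  assumes g: "g \<in> range (D1 F p)" "\<And>z. g \<bullet> D1 F p z = tr_shape_deriv z"
    and A: "A = (\<lambda>v. ocnj (F p) \<odot> D1 N p v + ocnj (D1 F p v) \<odot> N p)"
    and B: "B = (\<lambda>u v. (ocnj (F p) \<odot> D2 N p u v + ocnj (D1 F p u) \<odot> D1 N p v)
      + (ocnj (D1 F p v) \<odot> D1 N p u + ocnj (D2 F p u v) \<odot> N p))"
  shows "lap A B = - (ocnj (F p) \<odot> g) - (6 + shape_sq) *\<^sub>R (ocnj (F p) \<odot> N p)"
proof -
  interpret bounded_bilinear "\<lambda>u v. ocnj u \<odot> v"
    by (rule bounded_bilinear_ocnj_omult)
  have "lap A B = (\<Sum>w\<in>W. ocnj (F p) \<odot> (D2 N p (e w) (e w) - D1 N p (corr w))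
     + ocnj (D2 F p (e w) (e w) - D1 F p (corr w)) \<odot> N p + 2 *\<^sub>R (ocnj w \<odot> D1 N p (e w)))"
    unfolding lap_def A B
    by (rule sum.cong) (simp_all add: F1_e diff_left diff_right scaleR_2)
  also have "\<dots> = ocnj (F p) \<odot> lap (D1 N p) (D2 N p) + ocnj (lap (D1 F p) (D2 F p)) \<odot> N p
      + 2 *\<^sub>R (\<Sum>w\<in>W. ocnj w \<odot> D1 N p (e w))"
    unfolding lap_def sum_left sum_right by (simp add: sum.distrib scaleR_sum_right)
  also have "\<dots> = - (ocnj (F p) \<odot> g) - (6 + shape_sq) *\<^sub>R (ocnj (F p) \<odot> N p)"
  proof -
    have "ocnj (F p) \<odot> lap (D1 N p) (D2 N p) = tr_shape *\<^sub>R oone - shape_sq *\<^sub>R (ocnj (F p) \<odot> N p) - ocnj (F p) \<odot> g"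
      by (simp add: lap_N[OF g] diff_right scaleR_right ocnj_omult_self unit_F p)
    moreover have "ocnj (lap (D1 F p) (D2 F p)) \<odot> N p = tr_shape *\<^sub>R oone - 6 *\<^sub>R (ocnj (F p) \<odot> N p)"
      by (simp add: lap_F diff_left scaleR_left ocnj_omult_self unit_N p)
    moreover have "(2 * tr_shape) *\<^sub>R oone = tr_shape *\<^sub>R oone + tr_shape *\<^sub>R oone"
      by (metis mult_2 scaleR_add_left)
    ultimately show ?thesis
      by (simp add: sum_ocnj_omult_N1 scaleR_add_left)
  qed
  finally show ?thesis .
qed

text \<open>If \<open>\<xi>\<close> is the coordinate gradient of a function with first derivative \<open>A\<close> and second derivative
  \<open>B\<close> at \<open>p\<close>, and \<open>\<Gamma>\<close> is the Christoffel part of its covariant derivative, then the trace of the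
  covariant derivative is the Laplacian. It suffices to differentiate the equation that
  characterises \<open>\<xi>\<close>, so that derivatives of the inverse metric do not appear.\<close>

lemma divergence_gradient:
  assumes \<xi>: "\<And>z v. z \<in> U \<Longrightarrow> D1 F z (\<xi> z) \<bullet> D1 F z v = A z v"
    and A: "\<And>v. ((\<lambda>z. A z v) has_derivative (\<lambda>u. B u v)) (at p)"
    and \<Gamma>: "linear \<Gamma>" "\<And>v w. D1 F p (\<Gamma> v) \<bullet> D1 F p w = D2 F p v (\<xi> p) \<bullet> D1 F p w"
  shows "\<xi> differentiable at p"
    and "trace (matrix (\<lambda>v. D1 \<xi> p v + \<Gamma> v)) = lap (A p) B"
proof -
  show dif: "\<xi> differentiable at p"
    by (rule metric_solution_differentiable[OF p \<xi>]) (use A in \<open>auto simp: differentiable_def\<close>)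
  then have D: "(\<xi> has_derivative D1 \<xi> p) (at p)"
    by (simp add: D1_def frechet_derivative_works)
  have lin: "linear (\<lambda>v. D1 \<xi> p v + \<Gamma> v)"
    using linear_compose_add[OF has_derivative_linear[OF D] \<Gamma>(1)] .
  have B: "D1 F p (D1 \<xi> p v) \<bullet> D1 F p w + D2 F p v (\<xi> p) \<bullet> D1 F p w + D1 F p (\<xi> p) \<bullet> D2 F p v w = B v w" for v w
    using derivative_eq_on[OF open_U p has_derivative_inner[OF has_derivative_F1_field[OF p D] F2[OF p]] A[of w] \<xi>, of v]
    by (simp add: inner_add_left)
  have "trace (matrix (\<lambda>v. D1 \<xi> p v + \<Gamma> v)) = (\<Sum>w\<in>W. D1 F p (D1 \<xi> p (e w) + \<Gamma> (e w)) \<bullet> w)"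
    unfolding e_def by (rule trace_frame[OF linear_F1[OF p] immersion[OF p] W(1) lin])
  also have "\<dots> = lap (A p) B"
    unfolding lap_def
  proof (rule sum.cong[OF refl])
    fix w assume w: "w \<in> W"
    have "A p (corr w) = D2 F p (e w) (e w) \<bullet> D1 F p (\<xi> p)"
      using F1_corr[of "D1 F p (\<xi> p)" w] by (simp add: \<xi>[OF p, symmetric] inner_commute)
    then show "D1 F p (D1 \<xi> p (e w) + \<Gamma> (e w)) \<bullet> w = B (e w) (e w) - A p (corr w)"
      using B[of "e w" "e w"] \<Gamma>(2)[of "e w" "e w"] linear_F1[OF p] w
      by (simp add: F1_e linear_add inner_add_left inner_add_right inner_commute)
  qed
  finally show "trace (matrix (\<lambda>v. D1 \<xi> p v + \<Gamma> v)) = lap (A p) B" .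
qed

text \<open>The same method applied to the coordinate expression \<open>\<zeta>\<close> of the shape operator.\<close>

lemma tr_shape_has_derivative:
  assumes \<zeta>: "\<And>z v. z \<in> U \<Longrightarrow> D1 F z (\<zeta> z v) = - D1 N z v"
  shows "((\<lambda>z. trace (matrix (\<zeta> z))) has_derivative tr_shape_deriv) (at p)"
proof -
  have dif: "(\<lambda>z. \<zeta> z v) differentiable at p" for v
  proof (rule metric_solution_differentiable[OF p])
    show "D1 F z (\<zeta> z v) \<bullet> D1 F z w = - D1 N z v \<bullet> D1 F z w" if "z \<in> U" for z w
      using \<zeta>[OF that] by simp
    show "(\<lambda>z. - D1 N z v \<bullet> D1 F z w) differentiable at p" for w
      using has_derivative_inner[OF has_derivative_minus[OF N2] F2, OF p p]
      by (auto simp: differentiable_def)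
  qed
  \<comment> \<open>differentiating \<open>dF \<zeta> = - dN\<close>\<close>
  define \<zeta>' where "\<zeta>' v = D1 (\<lambda>z. \<zeta> z v) p" for v
  have D: "((\<lambda>z. \<zeta> z v) has_derivative \<zeta>' v) (at p)" for v
    using dif by (simp add: \<zeta>'_def D1_def frechet_derivative_works)
  have eq: "D1 F p (\<zeta>' v z) = - D2 N p z v - D2 F p z (\<zeta> p v)" for v z
    using derivative_eq_on[OF open_U p has_derivative_F1_field[OF p D[of v]] has_derivative_minus[OF N2[OF p, of v]] \<zeta>, of z]
    by (simp add: algebra_simps eq_neg_iff_add_eq_0)
  have lin\<zeta>: "linear (\<zeta> p)"
    by (rule linearI; rule injD[OF immersion[OF p]])
      (simp_all add: \<zeta> p linear_add[OF linear_F1[OF p]] linear_cmul[OF linear_F1[OF p]]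
        linear_add[OF linear_N1[OF p]] linear_cmul[OF linear_N1[OF p]])
  have lin: "linear (\<lambda>v. \<zeta>' v z)" for z
    by (rule linearI; rule injD[OF immersion[OF p]])
      (simp_all add: eq linear_add[OF linear_F1[OF p]] linear_cmul[OF linear_F1[OF p]]
        linear_add[OF lin\<zeta>] linear_cmul[OF lin\<zeta>] linear_add[OF linear_F2(2)[OF p]] linear_cmul[OF linear_F2(2)[OF p]]
        linear_add[OF linear_N2(2)[OF p]] linear_cmul[OF linear_N2(2)[OF p]] algebra_simps)
  have "((\<lambda>z. trace (matrix (\<zeta> z))) has_derivative (\<lambda>z. trace (matrix (\<lambda>v. \<zeta>' v z)))) (at p)"
    unfolding trace_def matrix_def vec_lambda_beta
    by (intro has_derivative_sum bounded_linear.has_derivative[OF bounded_linear_vec_nth D])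
  moreover have "trace (matrix (\<lambda>v. \<zeta>' v z)) = tr_shape_deriv z" for z
  proof -
    have "trace (matrix (\<lambda>v. \<zeta>' v z)) = (\<Sum>w\<in>W. D1 F p (\<zeta>' (e w) z) \<bullet> w)"
      unfolding e_def by (rule trace_frame[OF linear_F1[OF p] immersion[OF p] W(1) lin])
    also have "\<dots> = (\<Sum>w\<in>W. - (D2 N p z (e w) \<bullet> w)) - (\<Sum>w\<in>W. D2 F p z (\<zeta> p (e w)) \<bullet> w)"
      by (simp add: eq inner_diff_left sum_subtractf)
    \<comment> \<open>expand \<open>\<zeta>\<close> in the basis, then use the symmetry of the second fundamental form\<close>
    also have "(\<Sum>w\<in>W. D2 F p z (\<zeta> p (e w)) \<bullet> w) = (\<Sum>w\<in>W. \<Sum>b\<in>W. - (D1 N p (e w) \<bullet> b) * (D2 F p z (e b) \<bullet> w))"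
    proof (rule sum.cong[OF refl])
      fix w
      have "\<zeta> p (e w) = (\<Sum>b\<in>W. (- (D1 N p (e w) \<bullet> b)) *\<^sub>R e b)" (is "_ = ?r")
      proof (rule injD[OF immersion[OF p]])
        have "D1 F p ?r = (\<Sum>b\<in>W. (- (D1 N p (e w) \<bullet> b)) *\<^sub>R b)"
          using linear_F1[OF p] by (simp only: linear_sum linear_cmul F1_e cong: sum.cong)
        also have "\<dots> = - (\<Sum>b\<in>W. (D1 N p (e w) \<bullet> b) *\<^sub>R b)"
          by (simp add: sum_negf)
        also have "\<dots> = D1 F p (\<zeta> p (e w))"
          by (simp add: W_expansion N1_tangent p \<zeta>)
        finally show "D1 F p (\<zeta> p (e w)) = D1 F p ?r" ..
      qed
      then show "D2 F p z (\<zeta> p (e w)) \<bullet> w = (\<Sum>b\<in>W. - (D1 N p (e w) \<bullet> b) * (D2 F p z (e b) \<bullet> w))"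
        using linear_F2(2)[OF p, of z] by (simp only: linear_sum linear_cmul inner_sum_left inner_scaleR_left)
    qed
    also have "\<dots> = (\<Sum>b\<in>W. \<Sum>w\<in>W. - (D2 F p z (e b) \<bullet> w) * (D1 N p (e b) \<bullet> w))"
    proof (subst sum.swap, intro sum.cong refl)
      fix b w assume "b \<in> W" "w \<in> W"
      then show "- (D1 N p (e w) \<bullet> b) * (D2 F p z (e b) \<bullet> w) = - (D2 F p z (e b) \<bullet> w) * (D1 N p (e b) \<bullet> w)"
        using N1_F1_sym[OF p, of "e w" "e b"] by (simp add: F1_e)
    qed
    also have "\<dots> = (\<Sum>b\<in>W. - (D2 F p z (e b) \<bullet> D1 N p (e b)))"
      using W_inner_expansion[OF N1_tangent[OF p]] by (simp add: sum_negf)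
    finally show ?thesis
      by (simp add: tr_shape_deriv_def sum_subtractf sum_negf inner_commute)
  qed
  ultimately show ?thesis by simp
qed

end

section \<open>Changes of charts\<close>

lemma chart_facts:
  assumes "is_chart M c"
  shows "q \<in> fst c \<Longrightarrow> param c (snd c q) = q"
    and "y \<in> snd c ` fst c \<Longrightarrow> snd c (param c y) = y"
    and "y \<in> snd c ` fst c \<Longrightarrow> param c y \<in> fst c"
    and "open (snd c ` fst c)"
    and "openin M V \<Longrightarrow> open (snd c ` (fst c \<inter> V))"
    and "fst c \<subseteq> topspace M"
proof -
  have op: "openin M (fst c)"
    and hom: "homeomorphic_map (subtopology M (fst c)) (top_of_set (snd c ` fst c)) (snd c)"
    using assms by (auto simp: is_chart_def)
  show sub: "fst c \<subseteq> topspace M"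
    using op openin_subset by blast
  have ts: "topspace (subtopology M (fst c)) = fst c"
    using sub by auto
  have inj: "inj_on (snd c) (fst c)"
    using hom ts by (simp add: homeomorphic_eq_everything_map)
  show "q \<in> fst c \<Longrightarrow> param c (snd c q) = q"
    using inj by (simp add: param_def)
  show "y \<in> snd c ` fst c \<Longrightarrow> snd c (param c y) = y"
    by (simp add: param_def f_inv_into_f)
  show "y \<in> snd c ` fst c \<Longrightarrow> param c y \<in> fst c"
    by (simp add: param_def inv_into_into)
  show opU: "open (snd c ` fst c)"
    using assms by (simp add: is_chart_def)
  assume "openin M V"
  then have "openin (subtopology M (fst c)) (fst c \<inter> V)"
    by (simp add: openin_subtopology_Int2)
  then have "openin (top_of_set (snd c ` fst c)) (snd c ` (fst c \<inter> V))"
    using homeomorphic_imp_open_map[OF hom] by (simp add: open_map_def)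
  then show "open (snd c ` (fst c \<inter> V))"
    using opU openin_open_trans by blast
qed

text \<open>A topological space with a smooth atlas of charts into \<open>\<real>\<^sup>6\<close>.\<close>

locale atlas =
  fixes M :: "'m topology" and \<A> :: "'m chart set"
  assumes atlas: "smooth_atlas M \<A>"
begin

lemma charts: "c \<in> \<A> \<Longrightarrow> is_chart M c"
  using atlas by (simp add: smooth_atlas_def)

lemmas param_snd = chart_facts(1)[OF charts]
lemmas snd_param = chart_facts(2)[OF charts]
lemmas param_in = chart_facts(3)[OF charts]
lemmas open_chart = chart_facts(4)[OF charts]
lemmas chart_topspace = chart_facts(6)[OF charts]

lemma open_overlap: "c \<in> \<A> \<Longrightarrow> d \<in> \<A> \<Longrightarrow> open (snd c ` (fst c \<inter> fst d))"
  using chart_facts(5)[OF charts, of c "fst d"] charts[of d] by (simp add: is_chart_def)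

lemma chart_at:
  assumes "q \<in> topspace M"
  shows "chart_at \<A> q \<in> \<A>" "q \<in> fst (chart_at \<A> q)"
proof -
  have "(\<Union>c\<in>\<A>. fst c) = topspace M"
    using atlas by (simp add: smooth_atlas_def)
  then have "\<exists>c. c \<in> \<A> \<and> q \<in> fst c"
    using assms by blast
  then show "chart_at \<A> q \<in> \<A>" "q \<in> fst (chart_at \<A> q)"
    unfolding chart_at_def by (metis (mono_tags, lifting) someI_ex)+
qed

text \<open>The coordinate change from \<open>d\<close> to \<open>c\<close> is the map \<open>snd c\<close> read in the chart \<open>d\<close>, so its derivative
  is an instance of \<open>cderiv\<close>.\<close>

lemma transition_derivative:
  assumes "c \<in> \<A>" "d \<in> \<A>" "q \<in> fst c" "q \<in> fst d"
  shows "((snd c \<circ> param d) has_derivative cderiv d (snd c) q) (at (snd d q))"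
proof -
  have "smooth_on (snd d ` (fst d \<inter> fst c)) (snd c \<circ> param d)"
    using atlas assms(1,2) by (simp add: smooth_atlas_def)
  then show ?thesis
    using smooth_on_D1[OF _ open_overlap[OF assms(2,1)], of "snd c \<circ> param d" "snd d q"] assms
    by (simp add: D1_def cderiv_def)
qed

lemma cderiv_change:
  assumes "c \<in> \<A>" "d \<in> \<A>" "q \<in> fst c" "q \<in> fst d"
    and u: "((u \<circ> param c) has_derivative u') (at (snd c q))"
  shows "cderiv d u q = u' \<circ> cderiv d (snd c) q"
proof -
  have "((\<lambda>y. (u \<circ> param c) ((snd c \<circ> param d) y)) has_derivative (\<lambda>v. u' (cderiv d (snd c) q v))) (at (snd d q))"
    by (rule has_derivative_compose[OF transition_derivative[OF assms(1-4)]])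
      (use u assms in \<open>simp add: param_snd comp_def\<close>)
  then have "((u \<circ> param d) has_derivative (\<lambda>v. u' (cderiv d (snd c) q v))) (at (snd d q))"
    by (rule has_derivative_transform_within_open[OF _ open_overlap[OF assms(2,1)]])
      (use assms in \<open>auto simp: param_snd\<close>)
  then show ?thesis
    using frechet_derivative_at[symmetric] by (simp add: cderiv_def[of d u q] comp_def)
qed

lemma transition_inverse:
  assumes "c \<in> \<A>" "d \<in> \<A>" "q \<in> fst c" "q \<in> fst d"
  shows "cderiv c (snd d) q \<circ> cderiv d (snd c) q = id"
proof -
  have "((snd d \<circ> param d) has_derivative id) (at (snd d q))"
    by (rule has_derivative_transform_within_open[OF has_derivative_id open_chart[OF assms(2)]])
      (use assms in \<open>auto simp: param_snd id_def\<close>)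
  then have "cderiv d (snd d) q = id"
    unfolding cderiv_def using frechet_derivative_at by metis
  then show ?thesis
    using cderiv_change[OF assms transition_derivative[OF assms(2,1,4,3)]] by simp
qed

lemma transition_linear:
  assumes "c \<in> \<A>" "d \<in> \<A>" "q \<in> fst c" "q \<in> fst d"
  shows "linear (cderiv d (snd c) q)"
  using transition_derivative[OF assms] has_derivative_linear by blast

end

section \<open>The hypersurface in a chart\<close>

text \<open>An oriented immersed hypersurface.\<close>

locale hypersurface = atlas M \<A> for M :: "'m topology" and \<A> +
  fixes f \<eta> :: "'m \<Rightarrow> oct"
  assumes immersed: "immersed_hypersurface M \<A> f"
    and normal: "unit_normal M \<A> f \<eta>"

text \<open>A chart \<open>c\<close> is fixed, and the operators at a point with coordinates \<open>y\<close>, which refer to the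
  chart chosen at that point, are expressed in \<open>c\<close>.\<close>

locale hypersurface_chart = hypersurface +
  fixes c :: "'m chart"
  assumes c: "c \<in> \<A>"
begin

text \<open>The coordinate domain, the immersion and the normal in the chart \<open>c\<close>.\<close>

definition U :: "(real^6) set" where "U = snd c ` fst c"
definition F :: "real^6 \<Rightarrow> oct" where "F = f \<circ> param c"
definition N :: "real^6 \<Rightarrow> oct" where "N = \<eta> \<circ> param c"

lemma open_U: "open U"
  unfolding U_def by (rule open_chart[OF c])

lemma smooth_F: "smooth_on U F"
  using immersed c unfolding immersed_hypersurface_def smooth_map_def U_def F_def by blast

lemma smooth_N: "smooth_on U N"
  using normal c unfolding unit_normal_def smooth_map_def U_def N_def by blast

lemma snd_param_U: "y \<in> U \<Longrightarrow> snd c (param c y) = y"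
  unfolding U_def by (rule snd_param[OF c])

lemma param_topspace: "y \<in> U \<Longrightarrow> param c y \<in> topspace M"
  using param_in[OF c] chart_topspace[OF c] by (auto simp: U_def)

lemma F_param: "f (param c y) = F y"
  by (simp add: F_def)

lemma cderiv_D1: "y \<in> U \<Longrightarrow> cderiv c u (param c y) = D1 (u \<circ> param c) y"
  by (simp add: cderiv_def D1_def snd_param_U)

lemma cderiv_f: "y \<in> U \<Longrightarrow> cderiv c f (param c y) = D1 F y"
  by (simp add: cderiv_D1 F_def)

text \<open>The coordinate change at the point with coordinates \<open>y\<close>, from the chart chosen there to
  \<open>c\<close>, and its inverse.\<close>

definition T :: "real^6 \<Rightarrow> real^6 \<Rightarrow> real^6" where
  "T y = cderiv (chart_at \<A> (param c y)) (snd c) (param c y)"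

definition T' :: "real^6 \<Rightarrow> real^6 \<Rightarrow> real^6" where
  "T' y = cderiv c (snd (chart_at \<A> (param c y))) (param c y)"

lemma T:
  assumes "y \<in> U"
  shows "linear (T y)" "linear (T' y)" "T' y (T y v) = v" "T y (T' y v) = v"
proof -
  let ?q = "param c y"
  have a: "chart_at \<A> ?q \<in> \<A>" "?q \<in> fst (chart_at \<A> ?q)" "?q \<in> fst c"
    using assms chart_at param_topspace param_in[OF c] by (auto simp: U_def)
  show "linear (T y)" "linear (T' y)" "T' y (T y v) = v" "T y (T' y v) = v"
    using transition_linear[OF c a(1,3,2)] transition_linear[OF a(1) c a(2,3)]
      transition_inverse[OF c a(1,3,2)] transition_inverse[OF a(1) c a(2,3)]
    by (simp_all add: T_def T'_def fun_eq_iff)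
qed

lemma mderiv_chart:
  assumes "y \<in> U" "((u \<circ> param c) has_derivative u') (at y)"
  shows "mderiv \<A> u (param c y) = (\<lambda>v. u' (T y v))"
  using cderiv_change[OF c, of "chart_at \<A> (param c y)" "param c y" u u'] assms
    chart_at[OF param_topspace[OF assms(1)]] param_in[OF c]
  by (simp add: mderiv_def T_def U_def snd_param[OF c] comp_def)

lemma mderiv_f: "y \<in> U \<Longrightarrow> mderiv \<A> f (param c y) = (\<lambda>v. D1 F y (T y v))"
  using mderiv_chart[of y f] smooth_on_D1[OF smooth_F open_U] by (simp add: F_def)

lemma mderiv_\<eta>: "y \<in> U \<Longrightarrow> mderiv \<A> \<eta> (param c y) = (\<lambda>v. D1 N y (T y v))"
  using mderiv_chart[of y \<eta>] smooth_on_D1[OF smooth_N open_U] by (simp add: N_def)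

lemma tangent_space_chart:
  assumes "y \<in> U"
  shows "tangent_space \<A> f (param c y) = range (D1 F y)"
proof -
  have "surj (T y)"
    using T(4)[OF assms] by (metis surjI)
  then have "range (\<lambda>v. D1 F y (T y v)) = range (D1 F y)"
    by (metis image_image)
  then show ?thesis
    by (simp add: tangent_space_def mderiv_f[OF assms])
qed

sublocale hypersurface_patch U F N
proof
  fix y v assume y: "y \<in> U"
  let ?q = "param c y"
  have q: "?q \<in> topspace M" using param_topspace[OF y] .
  have "inj (mderiv \<A> f ?q)"
    using immersed q by (simp add: immersed_hypersurface_def)
  then have "inj (\<lambda>v. D1 F y (T y v))"
    by (simp only: mderiv_f[OF y])
  then show "inj (D1 F y)"
    using T(4)[OF y] by (metis (mono_tags, lifting) injD injI)
  have *: "f ?q \<in> sphere 0 1" "\<eta> ?q \<in> sphere_tangent (f ?q)" "norm (\<eta> ?q) = 1"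
    "\<And>w. w \<in> tangent_space \<A> f ?q \<Longrightarrow> \<eta> ?q \<bullet> w = 0"
    using immersed normal q by (auto simp: immersed_hypersurface_def unit_normal_def)
  then show "F y \<bullet> F y = 1" "N y \<bullet> N y = 1" "N y \<bullet> F y = 0"
    by (auto simp: F_def N_def sphere_tangent_def norm_eq_1)
  show "N y \<bullet> D1 F y v = 0"
    using *(4) tangent_space_chart[OF y] by (simp add: N_def)
qed (rule open_U smooth_F smooth_N)+

lemma inv_mderiv_f:
  assumes "y \<in> U"
  shows "inv (mderiv \<A> f (param c y)) (D1 F y v) = T' y v"
proof -
  have "inj (mderiv \<A> f (param c y))"
    using immersed param_topspace[OF assms] by (simp add: immersed_hypersurface_def)
  then show ?thesis
    by (rule inv_f_eq) (simp add: mderiv_f T assms)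
qed

text \<open>If \<open>\<phi>\<close> is the expression of \<open>L\<close> in \<open>c\<close>, then its expression in any other chart is conjugate to
  \<open>\<phi>\<close> and has the same trace.\<close>

lemma tangent_trace_chart:
  assumes y: "y \<in> U" and \<phi>: "linear \<phi>" "\<And>v. L (D1 F y v) = D1 F y (\<phi> v)"
  shows "tangent_trace \<A> f (param c y) L = trace (matrix \<phi>)"
proof -
  note [simp] = T[OF y]
  have "inv (mderiv \<A> f (param c y)) \<circ> L \<circ> mderiv \<A> f (param c y) = T' y \<circ> (\<phi> \<circ> T y)"
  proof
    fix v
    have "L (mderiv \<A> f (param c y) v) = D1 F y (\<phi> (T y v))"
      by (simp add: mderiv_f[OF y] \<phi>(2))
    then show "(inv (mderiv \<A> f (param c y)) \<circ> L \<circ> mderiv \<A> f (param c y)) v = (T' y \<circ> (\<phi> \<circ> T y)) v"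
      by (simp add: inv_mderiv_f[OF y])
  qed
  then have "tangent_trace \<A> f (param c y) L = trace (matrix (T' y) ** matrix (\<phi> \<circ> T y))"
    using \<phi>(1) by (simp add: tangent_trace_def matrix_compose linear_compose)
  also have "\<dots> = trace (matrix (\<phi> \<circ> T y) ** matrix (T' y))"
    by (rule trace_matrix_mult_commute)
  also have "\<dots> = trace (matrix ((\<phi> \<circ> T y) \<circ> T' y))"
    using \<phi>(1) by (simp add: matrix_compose linear_compose)
  also have "(\<phi> \<circ> T y) \<circ> T' y = \<phi>"
    by (simp add: fun_eq_iff)
  finally show ?thesis .
qed

lemma grad_chart:
  assumes y: "y \<in> U" and u: "((u \<circ> param c) has_derivative u') (at y)"
    and \<xi>: "\<And>v. D1 F y \<xi> \<bullet> D1 F y v = u' v"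
  shows "grad \<A> f u (param c y) = D1 F y \<xi>"
  unfolding grad_def mderiv_f[OF y] mderiv_chart[OF y u] tangent_space_chart[OF y]
proof (rule the_equality)
  show "D1 F y \<xi> \<in> range (D1 F y) \<and> (\<forall>v. D1 F y \<xi> \<bullet> D1 F y (T y v) = u' (T y v))"
    by (simp add: \<xi>)
  fix w assume w: "w \<in> range (D1 F y) \<and> (\<forall>v. w \<bullet> D1 F y (T y v) = u' (T y v))"
  then obtain s where s: "w = D1 F y s" by blast
  have "w \<bullet> D1 F y v = u' v" for v
    using w T(4)[OF y] by metis
  then have "(w - D1 F y \<xi>) \<bullet> D1 F y (s - \<xi>) = 0"
    by (simp add: inner_diff_left \<xi>)
  then show "w = D1 F y \<xi>"
    using linear_F1[OF y] by (simp add: s linear_diff)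
qed

text \<open>The shape operator in coordinates.\<close>

definition \<zeta> :: "real^6 \<Rightarrow> real^6 \<Rightarrow> real^6" where
  "\<zeta> y v = inv (D1 F y) (- D1 N y v)"

lemma F1_\<zeta>:
  assumes "y \<in> U"
  shows "D1 F y (\<zeta> y v) = - D1 N y v"
proof -
  have "- D1 N y v = D1 N y (- v)"
    using linear_N1[OF assms] by (simp add: linear_neg)
  then show ?thesis
    using N1_tangent[OF assms, of "- v"] by (simp add: \<zeta>_def f_inv_into_f)
qed

lemma linear_\<zeta>:
  assumes y: "y \<in> U"
  shows "linear (\<zeta> y)"
  by (rule linearI; rule injD[OF immersion[OF y]])
    (simp_all add: F1_\<zeta> y linear_add[OF linear_F1[OF y]] linear_cmul[OF linear_F1[OF y]]
      linear_add[OF linear_N1[OF y]] linear_cmul[OF linear_N1[OF y]])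

lemma shape_chart:
  assumes "y \<in> U"
  shows "shape \<A> f \<eta> (param c y) (D1 F y v) = D1 F y (\<zeta> y v)"
  using N1_F[OF assms]
  by (simp add: shape_def sphere_connection_def inv_mderiv_f mderiv_\<eta> T F1_\<zeta> assms F_param)

lemma mean_curvature_chart:
  "y \<in> U \<Longrightarrow> mean_curvature \<A> f \<eta> (param c y) = (1/6) * trace (matrix (\<zeta> y))"
  by (simp add: mean_curvature_def tangent_trace_chart[OF _ linear_\<zeta> shape_chart])

lemma shape_norm_sq_chart:
  "y \<in> U \<Longrightarrow> shape_norm_sq \<A> f \<eta> (param c y) = trace (matrix (\<zeta> y \<circ> \<zeta> y))"
  unfolding shape_norm_sq_def
  by (rule tangent_trace_chart) (simp_all add: shape_chart linear_compose linear_\<zeta>)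

text \<open>The Christoffel symbols are the coefficients of the tangential part of the second derivative of
  the immersion.\<close>

lemma christoffel_chart:
  assumes y: "y \<in> U"
  shows "(\<Sum>k\<in>UNIV. christoffel c f k i j (param c y) *\<^sub>R D1 F y (axis k 1)) \<bullet> D1 F y (axis m 1)
     = D2 F y (axis i 1) (axis j 1) \<bullet> D1 F y (axis m 1)"
proof -
  let ?q = "param c y"
  have g: "metric_coeff c f k l (param c z) = gram z $ k $ l" if "z \<in> U" for k l z
    by (simp add: metric_coeff_def gram_def cderiv_f[OF that])
  have pdg: "pd c (metric_coeff c f k l) n ?q
      = D1 F y (axis k 1) \<bullet> D2 F y (axis n 1) (axis l 1) + D2 F y (axis n 1) (axis k 1) \<bullet> D1 F y (axis l 1)" for k l n
  proof -
    have "((metric_coeff c f k l \<circ> param c) has_derivative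
        (\<lambda>v. D1 F y (axis k 1) \<bullet> D2 F y v (axis l 1) + D2 F y v (axis k 1) \<bullet> D1 F y (axis l 1))) (at y)"
      by (rule has_derivative_transform_within_open[OF has_derivative_inner[OF F2 F2, OF y y] open_U y])
        (simp add: g gram_def)
    then show ?thesis
      unfolding cderiv_D1[OF y] D1_def by (subst frechet_derivative_at[symmetric]) auto
  qed
  have "invertible (gram y)"
    using invertible_gram[OF y] .
  then have "gram y ** matrix_inv (gram y) = mat 1"
    unfolding matrix_inv_def invertible_def by (metis (mono_tags, lifting) someI_ex)
  then have "(gram y ** matrix_inv (gram y)) $ m $ l = (if m = l then 1 else 0)" for l
    by (simp add: mat_def)
  moreover have "(\<chi> k l. metric_coeff c f k l ?q) = gram y"
    by (simp add: vec_eq_iff g[OF y])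
  ultimately have inv: "(\<Sum>k\<in>UNIV. gram y $ m $ k * metric_inv c f k l ?q) = (if m = l then 1 else 0)" for l
    by (simp add: matrix_matrix_mult_def metric_inv_def)
  define S where "S l = pd c (metric_coeff c f j l) i ?q + pd c (metric_coeff c f i l) j ?q
    - pd c (metric_coeff c f i j) l ?q" for l
  have S: "S m = 2 * (D2 F y (axis i 1) (axis j 1) \<bullet> D1 F y (axis m 1))"
    unfolding S_def pdg
    by (simp add: F2_sym[OF y, of "axis j 1" "axis i 1"] F2_sym[OF y, of "axis m 1"] inner_commute)
  have "(\<Sum>k\<in>UNIV. christoffel c f k i j ?q *\<^sub>R D1 F y (axis k 1)) \<bullet> D1 F y (axis m 1)
      = (\<Sum>k\<in>UNIV. \<Sum>l\<in>UNIV. (1/2) * S l * (gram y $ m $ k * metric_inv c f k l ?q))"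
  proof -
    have "(\<Sum>k\<in>UNIV. christoffel c f k i j ?q *\<^sub>R D1 F y (axis k 1)) \<bullet> D1 F y (axis m 1)
        = (\<Sum>k\<in>UNIV. christoffel c f k i j ?q * gram y $ m $ k)"
      by (simp add: inner_sum_left inner_sum_right gram_def inner_commute[of _ "D1 F y (axis m 1)"])
    then show ?thesis
      by (simp add: christoffel_def S_def sum_distrib_left sum_distrib_right mult_ac)
  qed
  also have "\<dots> = (\<Sum>l\<in>UNIV. (1/2) * S l * (if m = l then 1 else 0))"
    by (subst sum.swap) (simp only: sum_distrib_left[symmetric] inv)
  also have "\<dots> = (1/2) * S m"
    by (simp add: if_distrib cong: if_cong)
  finally show ?thesis
    by (simp add: S)
qed

text \<open>The connection at \<open>y\<close> differentiates components in the chart chosen at \<open>y\<close>, so this chart is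
  required to be \<open>c\<close>.\<close>

lemma levi_civita_chart:
  assumes y: "y \<in> U" and c_at: "chart_at \<A> (param c y) = c"
    and X: "\<And>z. z \<in> U \<Longrightarrow> X (param c z) = D1 F z (\<xi> z)"
    and \<xi>: "\<xi> differentiable at y"
    and \<Gamma>: "\<Gamma> = (\<lambda>v. \<chi> k. \<Sum>i\<in>UNIV. \<Sum>j\<in>UNIV. christoffel c f k i j (param c y) * v $ i * \<xi> y $ j)"
  shows "levi_civita \<A> f X (param c y) (D1 F y v) = D1 F y (D1 \<xi> y v + \<Gamma> v)"
proof -
  have comp: "component c f X k (param c z) = \<xi> z $ k" if "z \<in> U" for k z
    by (simp add: component_def cderiv_f X immersion that)
  have D: "(\<xi> has_derivative D1 \<xi> y) (at y)"
    using \<xi> by (simp add: D1_def frechet_derivative_works)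
  have cd: "((component c f X k \<circ> param c) has_derivative (\<lambda>v. D1 \<xi> y v $ k)) (at y)" for k
    by (rule has_derivative_transform_within_open[OF
          bounded_linear.has_derivative[OF bounded_linear_vec_nth D] open_U y]) (simp add: comp)
  have "cderiv c (component c f X k) (param c y) = (\<lambda>v. D1 \<xi> y v $ k)" for k
    unfolding cderiv_def snd_param_U[OF y] by (rule frechet_derivative_at[OF cd, symmetric])
  then have "levi_civita \<A> f X (param c y) (D1 F y v) = (\<Sum>k\<in>UNIV. (D1 \<xi> y v + \<Gamma> v) $ k *\<^sub>R D1 F y (axis k 1))"
    by (simp add: levi_civita_def c_at cderiv_f immersion y comp \<Gamma>)
  then show ?thesis
    using linear_vec_expansion[OF linear_F1[OF y], of "D1 \<xi> y v + \<Gamma> v"] by simp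
qed

lemma christoffel_form_chart:
  assumes y: "y \<in> U"
    and \<Gamma>: "\<Gamma> = (\<lambda>v. \<chi> k. \<Sum>i\<in>UNIV. \<Sum>j\<in>UNIV. christoffel c f k i j (param c y) * v $ i * x $ j)"
  shows "linear \<Gamma>" and "D1 F y (\<Gamma> v) \<bullet> D1 F y w = D2 F y v x \<bullet> D1 F y w"
proof -
  show "linear \<Gamma>"
    unfolding \<Gamma> by (rule linearI) (simp_all add: vec_eq_iff sum_distrib_left sum.distrib algebra_simps)
  have "D1 F y (\<Gamma> v) \<bullet> D1 F y (axis m 1) = D2 F y v x \<bullet> D1 F y (axis m 1)" for m
  proof -
    let ?C = "\<lambda>k i j. christoffel c f k i j (param c y)"
    define Z where "Z i j = (\<Sum>k\<in>UNIV. ?C k i j *\<^sub>R D1 F y (axis k 1))" for i j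
    have "D1 F y (\<Gamma> v) = (\<Sum>k\<in>UNIV. \<Sum>i\<in>UNIV. \<Sum>j\<in>UNIV. (v $ i * x $ j) *\<^sub>R (?C k i j *\<^sub>R D1 F y (axis k 1)))"
      by (subst linear_vec_expansion[OF linear_F1[OF y]]) (simp add: \<Gamma> scaleR_sum_left mult_ac)
    also have "\<dots> = (\<Sum>i\<in>UNIV. \<Sum>k\<in>UNIV. \<Sum>j\<in>UNIV. (v $ i * x $ j) *\<^sub>R (?C k i j *\<^sub>R D1 F y (axis k 1)))"
      by (rule sum.swap)
    also have "\<dots> = (\<Sum>i\<in>UNIV. \<Sum>j\<in>UNIV. \<Sum>k\<in>UNIV. (v $ i * x $ j) *\<^sub>R (?C k i j *\<^sub>R D1 F y (axis k 1)))"
      by (intro sum.cong refl sum.swap)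
    also have "\<dots> = (\<Sum>i\<in>UNIV. \<Sum>j\<in>UNIV. (v $ i * x $ j) *\<^sub>R (\<Sum>k\<in>UNIV. ?C k i j *\<^sub>R D1 F y (axis k 1)))"
      by (simp only: scaleR_sum_right)
    finally have "D1 F y (\<Gamma> v) = (\<Sum>i\<in>UNIV. \<Sum>j\<in>UNIV. (v $ i * x $ j) *\<^sub>R Z i j)"
      by (simp only: Z_def)
    then have "D1 F y (\<Gamma> v) \<bullet> D1 F y (axis m 1)
        = (\<Sum>i\<in>UNIV. \<Sum>j\<in>UNIV. (v $ i * x $ j) * (D2 F y (axis i 1) (axis j 1) \<bullet> D1 F y (axis m 1)))"
      using christoffel_chart[OF y, folded Z_def] by (simp add: inner_sum_left)
    also have "\<dots> = D2 F y v x \<bullet> D1 F y (axis m 1)"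
      by (subst (2) bilinear_vec_expansion[where b="D2 F y", OF linear_F2[OF y]])
        (simp only: inner_sum_left inner_scaleR_left)
    finally show ?thesis .
  qed
  then show "D1 F y (\<Gamma> v) \<bullet> D1 F y w = D2 F y v x \<bullet> D1 F y w"
    using linear_vec_expansion[OF linear_F1[OF y], of w] by (simp add: inner_sum_right)
qed

end

section \<open>The Laplacian of the Gauss map\<close>

theorem theorem2:
  fixes M :: "'m topology" and \<A> :: "'m chart set" and f \<eta> :: "'m \<Rightarrow> oct"
    and B :: "oct set" and x :: 'm
  assumes "immersed_hypersurface M \<A> f"
    and "unit_normal M \<A> f \<eta>"
    and "orthonormal_basis B (sphere_tangent oone)"
    and "x \<in> topspace M"
  shows "vlaplacian B \<A> f (gauss_map f \<eta>) x =
           - 6 *\<^sub>R Gam (f x) (grad \<A> f (mean_curvature \<A> f \<eta>) x)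
           - (6 + shape_norm_sq \<A> f \<eta> x) *\<^sub>R gauss_map f \<eta> x"
proof -
  interpret hypersurface M \<A> f \<eta>
    using assms(1,2) by unfold_locales (auto simp: immersed_hypersurface_def smooth_manifold6_def)
  define c where "c = chart_at \<A> x"
  have cx: "c \<in> \<A>" "x \<in> fst c"
    using chart_at[OF assms(4)] by (auto simp: c_def)
  interpret hypersurface_chart M \<A> f \<eta> c
    by unfold_locales (rule cx)
  define p where "p = snd c x"
  have p: "p \<in> U" and px: "param c p = x"
    using cx(2) param_snd[OF cx(1)] unfolding p_def U_def by blast+
  obtain W where W: "orthonormal_basis W (range (D1 F p))" "card W = DIM(real^6)"
    using orthonormal_basis_exists[OF linear_F1[OF p] immersion[OF p]] by blast
  interpret hypersurface_frame U F N p W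
    by unfold_locales (use p W in auto)
  interpret cp: bounded_bilinear "\<lambda>u v. ocnj u \<odot> v"
    by (rule bounded_bilinear_ocnj_omult)

  have Gam_F: "Gam (F y) v = ocnj (F y) \<odot> v" if "y \<in> U" for y v
    using unit_F[OF that] by (simp add: Gam_def oinv_def norm_eq_1[symmetric])
  have gauss: "gauss_map f \<eta> (param c y) = ocnj (F y) \<odot> N y" if "y \<in> U" for y
    using Gam_F[OF that] by (simp add: gauss_map_def F_def N_def)

  \<comment> \<open>first derivative of the Gauss map in \<open>c\<close>, and second derivative at \<open>p\<close>\<close>
  define A where "A y v = ocnj (F y) \<odot> D1 N y v + ocnj (D1 F y v) \<odot> N y" for y v
  define A2 where "A2 u v = (ocnj (F p) \<odot> D2 N p u v + ocnj (D1 F p u) \<odot> D1 N p v)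
      + (ocnj (D1 F p v) \<odot> D1 N p u + ocnj (D2 F p u v) \<odot> N p)" for u v

  have t: "((\<lambda>z. trace (matrix (\<zeta> z))) has_derivative tr_shape_deriv) (at p)"
    by (rule tr_shape_has_derivative) (rule F1_\<zeta>)
  \<comment> \<open>the coordinate gradient of \<open>tr A = 6 H\<close>\<close>
  obtain h where h: "\<And>v. D1 F p h \<bullet> D1 F p v = tr_shape_deriv v"
    using riesz[OF p has_derivative_linear[OF t]] by blast
  have grad_H: "grad \<A> f (mean_curvature \<A> f \<eta>) x = (1/6) *\<^sub>R D1 F p h"
  proof -
    have "((mean_curvature \<A> f \<eta> \<circ> param c) has_derivative (\<lambda>v. (1/6) * tr_shape_deriv v)) (at p)"
      by (rule has_derivative_transform_within_open[OF has_derivative_mult_right[OF t, of "1/6"] open_U p])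
        (simp add: mean_curvature_chart)
    from grad_chart[OF p this, of "(1/6) *\<^sub>R h"] show ?thesis
      using linear_F1[OF p] by (simp add: linear_cmul h px)
  qed

  have norm_A: "shape_norm_sq \<A> f \<eta> x = shape_sq"
  proof -
    have "shape_norm_sq \<A> f \<eta> x = (\<Sum>w\<in>W. D1 F p ((\<zeta> p \<circ> \<zeta> p) (e w)) \<bullet> w)"
      using shape_norm_sq_chart[OF p]
        trace_frame[OF linear_F1[OF p] immersion[OF p] W(1), of "\<zeta> p \<circ> \<zeta> p"] linear_\<zeta>[OF p]
      by (simp add: px linear_compose e_def)
    also have "\<dots> = shape_sq"
      unfolding shape_sq_def
    proof (rule sum.cong[OF refl])
      fix w assume "w \<in> W"
      then show "D1 F p ((\<zeta> p \<circ> \<zeta> p) (e w)) \<bullet> w = D1 N p (e w) \<bullet> D1 N p (e w)"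
        using N1_F1_sym[OF p, of "\<zeta> p (e w)" "e w"] by (simp add: F1_\<zeta> p F1_e)
    qed
    finally show ?thesis .
  qed

  define R where "R = lap (A p) A2"
  have R: "R = - (ocnj (F p) \<odot> D1 F p h) - (6 + shape_sq) *\<^sub>R (ocnj (F p) \<odot> N p)"
    unfolding R_def by (rule lap_gauss) (auto simp: h A_def A2_def fun_eq_iff)

  have lapl: "laplacian \<A> f (\<lambda>q. gauss_map f \<eta> q \<bullet> b) x = R \<bullet> b" for b
  proof -
    let ?u = "\<lambda>q. gauss_map f \<eta> q \<bullet> b"
    have u: "((?u \<circ> param c) has_derivative (\<lambda>v. A y v \<bullet> b)) (at y)" if y: "y \<in> U" for y
      unfolding A_def
      by (rule has_derivative_transform_within_open[OF
            has_derivative_inner_left[OF cp.FDERIV[OF F1[OF y] N1[OF y]]] open_U y])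
        (simp add: gauss)
    have A: "((\<lambda>z. A z v \<bullet> b) has_derivative (\<lambda>u. A2 u v \<bullet> b)) (at p)" for v
      unfolding A_def A2_def
      by (intro has_derivative_inner_left has_derivative_add cp.FDERIV F1 N1 F2 N2 p)
    have "\<forall>y\<in>U. \<exists>s. \<forall>v. D1 F y s \<bullet> D1 F y v = A y v \<bullet> b"
      using riesz has_derivative_linear[OF u] by blast
    then obtain \<xi> where \<xi>: "\<And>y v. y \<in> U \<Longrightarrow> D1 F y (\<xi> y) \<bullet> D1 F y v = A y v \<bullet> b"
      by metis
    \<comment> \<open>the coordinate gradient of \<open>u\<close> is \<open>\<xi>\<close>, and \<open>\<Gamma>\<close> is the Christoffel part of its covariant derivative\<close>
    define \<Gamma> where "\<Gamma> = (\<lambda>v. \<chi> k. \<Sum>i\<in>UNIV. \<Sum>j\<in>UNIV. christoffel c f k i j (param c p) * v $ i * \<xi> p $ j)"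
    note \<Gamma> = christoffel_form_chart[OF p \<Gamma>_def]
    note div = divergence_gradient[OF \<xi> A \<Gamma>]
    have grad_u: "grad \<A> f ?u (param c y) = D1 F y (\<xi> y)" if "y \<in> U" for y
      by (rule grad_chart[OF that u[OF that] \<xi>[OF that]])
    have lin: "linear (\<lambda>v. D1 \<xi> p v + \<Gamma> v)"
    proof -
      have "linear (D1 \<xi> p)"
        using div(1) by (simp add: D1_def linear_frechet_derivative)
      then show ?thesis
        using \<Gamma>(1) by (rule linear_compose_add)
    qed
    have "laplacian \<A> f ?u (param c p) = trace (matrix (\<lambda>v. D1 \<xi> p v + \<Gamma> v))"
      unfolding laplacian_def divergence_def
      by (rule tangent_trace_chart[OF p lin], rule levi_civita_chart[OF p _ grad_u div(1) \<Gamma>_def])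
        (simp only: px, simp only: c_def)
    also have "\<dots> = R \<bullet> b"
      using div(2) by (simp add: R_def lap_def inner_sum_left inner_diff_left)
    finally show ?thesis
      by (simp add: px)
  qed

  \<comment> \<open>\<open>R\<close> is imaginary, hence recovered from its components in the basis \<open>B\<close>\<close>
  have "R \<in> sphere_tangent oone"
    using N_F[OF p] F1_F[OF p, of h]
    by (simp add: sphere_tangent_def R inner_diff_left ocnj_omult_inner_oone inner_commute[of "F p"])
  then have "vlaplacian B \<A> f (gauss_map f \<eta>) x = R"
    by (simp add: vlaplacian_def lapl orthonormal_expansion[OF assms(3)])
  also have "\<dots> = - 6 *\<^sub>R Gam (f x) (grad \<A> f (mean_curvature \<A> f \<eta>) x)
           - (6 + shape_norm_sq \<A> f \<eta> x) *\<^sub>R gauss_map f \<eta> x"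
    using Gam_F[OF p] gauss[OF p]
    by (simp add: R grad_H norm_A cp.scaleR_right px flip: F_param)
  finally show ?thesis .
qed

end
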